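(* Let $d\ge 1$ and let $G$ be an induced subgraph of the hypercube $Q_d$ with $n\le d$ vertices. If $n\ge 103$, then $\lambda_1(G)\le \sqrt{n-1}$, with equality if and only if $G$ is a star (i.e. $G\cong K_{1,n-1}$).
   Context: $Q_d$ is the $d$-dimensional hypercube: its vertex set is $\{0,1\}^d$ (equivalently, the subsets of $[d]=\{1,\dots,d\}$), and two vertices are adjacent iff they differ in exactly one coordinate. For a graph $G$, $\lambda_1(G)$ denotes the largest eigenvalue of its adjacency matrix. *)

theory Defs
  imports
    Complex_Main
    "Graph_Theory.Graph_Theory"
    "Jordan_Normal_Form.Spectral_Radius"
begin

text \<open>The vertex set of the hypercube is given by the subsets of the set of coordinates
  \<open>{1..d}\<close>. As in \<^theory>\<open>Graph_Theory.Digraph\<close>, an undirected graph is a symmetric digraph.\<close>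

definition hypercube :: "nat \<Rightarrow> (nat set, nat set \<times> nat set) pre_digraph" where
  "hypercube d = \<lparr> verts = Pow {1..d},
     arcs = {(A, B). A \<in> Pow {1..d} \<and> B \<in> Pow {1..d} \<and>
               (\<exists>!i. i \<in> {1..d} \<and> (i \<in> A) \<noteq> (i \<in> B))},
     tail = fst, head = snd \<rparr>"

definition adjacency_mat :: "'a list \<Rightarrow> ('a, 'b) pre_digraph \<Rightarrow> real mat" where
  "adjacency_mat vs G =
     mat (length vs) (length vs) (\<lambda>(i, j). if vs ! i \<rightarrow>\<^bsub>G\<^esub> vs ! j then 1 else 0)"

text \<open>The vertices are listed in an arbitrary order; by \<open>eigenvalue_adjacency_mat\<close> below the
  spectrum does not depend on it. By \<open>lambda1_eigenvalue\<close> and \<open>lambda1_ge\<close> the maximum is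
  attained for every nonempty graph.\<close>

definition lambda1 :: "('a, 'b) pre_digraph \<Rightarrow> real" where
  "lambda1 G =
     Max (spectrum (adjacency_mat (SOME vs. distinct vs \<and> set vs = verts G) G))"

lemma graph_hypercube: "graph (hypercube d)"
proof -
  have "arcs (hypercube d) \<subseteq> Pow {1..d} \<times> Pow {1..d}"
    by (auto simp: hypercube_def)
  then have f: "finite (arcs (hypercube d))"
    by (rule finite_subset) auto
  have "arcs_ends (hypercube d) = arcs (hypercube d)"
    by (auto simp: hypercube_def arcs_ends_def arc_to_ends_def)
  moreover have "(B, A) \<in> arcs (hypercube d)" if "(A, B) \<in> arcs (hypercube d)" for A B
  proof -
    let ?D = "\<lambda>A B i. i \<in> {1..d} \<and> (i \<in> A) \<noteq> (i \<in> B)"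
    have mem: "(A, B) \<in> arcs (hypercube d) \<longleftrightarrow>
        A \<in> Pow {1..d} \<and> B \<in> Pow {1..d} \<and> Ex1 (?D A B)" for A B
      by (simp only: hypercube_def pre_digraph.select_convs mem_Collect_eq prod.case)
    have *: "A \<in> Pow {1..d}" "B \<in> Pow {1..d}" "Ex1 (?D A B)"
      using that[unfolded mem] by (blast, blast, elim conjE)
    have "?D A B = ?D B A"
      by (rule ext, rule arg_cong2[of _ _ _ _ "(\<and>)", OF refl neq_commute])
    then have "Ex1 (?D B A)"
      by (rule subst[of _ _ Ex1]) (rule *)
    with *(1,2) show ?thesis
      unfolding mem by (intro conjI)
  qed
  ultimately have s: "sym (arcs_ends (hypercube d))"
    by (metis symI)
  show ?thesis
  proof
    show "finite (arcs (hypercube d))" by (rule f)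
    show "symmetric (hypercube d)" unfolding symmetric_def by (rule s)
    fix e assume e: "e \<in> arcs (hypercube d)"
    then obtain A B where AB: "e = (A, B)" "A \<in> Pow {1..d}" "B \<in> Pow {1..d}" "A \<noteq> B"
      by (auto simp: hypercube_def)
    then show "tail (hypercube d) e \<in> verts (hypercube d)"
        "head (hypercube d) e \<in> verts (hypercube d)"
        "tail (hypercube d) e \<noteq> head (hypercube d) e"
      by (simp_all add: hypercube_def)
  qed (simp_all add: hypercube_def arc_to_ends_def prod_eq_iff)
qed

lemma eigenvalue_adjacency_mat:
  assumes vs: "distinct vs" "set vs = verts G"
  shows "eigenvalue (adjacency_mat vs G) x \<longleftrightarrow>
    (\<exists>f. (\<exists>v \<in> verts G. f v \<noteq> 0) \<and>
         (\<forall>v \<in> verts G. (\<Sum>u | u \<in> verts G \<and> v \<rightarrow>\<^bsub>G\<^esub> u. f u) = x * f v))"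
    (is "_ = ?R")
proof -
  let ?n = "length vs"
  have fin: "finite (verts G)" using vs(2) by (metis List.finite_set)
  have sum_eq: "(\<Sum>j<?n. (if v \<rightarrow>\<^bsub>G\<^esub> vs ! j then 1 else 0) * f (vs ! j)) =
      (\<Sum>u | u \<in> verts G \<and> v \<rightarrow>\<^bsub>G\<^esub> u. f u)" for v and f :: "'a \<Rightarrow> real"
  proof -
    have "(\<Sum>j<?n. (if v \<rightarrow>\<^bsub>G\<^esub> vs ! j then 1 else 0) * f (vs ! j)) =
        (\<Sum>u \<in> set vs. (if v \<rightarrow>\<^bsub>G\<^esub> u then 1 else 0) * f u)"
      by (rule sum.reindex_bij_betw[OF bij_betw_nth[OF vs(1) refl refl]])
    also have "\<dots> = (\<Sum>u \<in> set vs. if v \<rightarrow>\<^bsub>G\<^esub> u then f u else 0)"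
      by (rule sum.cong) auto
    also have "\<dots> = (\<Sum>u \<in> {u \<in> set vs. v \<rightarrow>\<^bsub>G\<^esub> u}. f u)"
      by (simp add: sum.If_cases Int_def)
    finally show ?thesis using vs(2) by simp
  qed
  have mv: "adjacency_mat vs G *\<^sub>v w = x \<cdot>\<^sub>v w \<longleftrightarrow>
      (\<forall>i<?n. (\<Sum>j<?n. (if vs ! i \<rightarrow>\<^bsub>G\<^esub> vs ! j then 1 else 0) * w $ j) = x * w $ i)"
    if "w \<in> carrier_vec ?n" for w
    using that by (auto simp: adjacency_mat_def vec_eq_iff scalar_prod_def atLeast0LessThan)
  have all: "(\<forall>v \<in> verts G. P v) \<longleftrightarrow> (\<forall>i<?n. P (vs ! i))" for P
    using vs(2) by (metis in_set_conv_nth)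
  have ex: "(\<exists>v \<in> verts G. P v) \<longleftrightarrow> (\<exists>i<?n. P (vs ! i))" for P
    using all[of "\<lambda>v. \<not> P v"] by blast
  show ?thesis
  proof
    assume "eigenvalue (adjacency_mat vs G) x"
    then obtain w where w: "w \<in> carrier_vec ?n" "w \<noteq> 0\<^sub>v ?n" "adjacency_mat vs G *\<^sub>v w = x \<cdot>\<^sub>v w"
      by (auto simp: eigenvalue_def eigenvector_def adjacency_mat_def)
    define f where "f v = w $ (the_inv_into {..<?n} ((!) vs) v)" for v
    have f: "f (vs ! i) = w $ i" if "i < ?n" for i
      using that the_inv_into_f_f[of "(!) vs" "{..<?n}" i] vs(1)
      by (simp add: f_def inj_on_nth)
    have "\<exists>i<?n. w $ i \<noteq> 0" using w(1,2) by (auto simp: vec_eq_iff)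
    moreover have "\<forall>i<?n. (\<Sum>j<?n. (if vs ! i \<rightarrow>\<^bsub>G\<^esub> vs ! j then 1 else 0) * f (vs ! j)) = x * f (vs ! i)"
      using w(3) mv[OF w(1)] by (simp add: f)
    ultimately show ?R
      unfolding all ex sum_eq using f by metis
  next
    assume ?R
    then obtain f where f: "\<exists>i<?n. f (vs ! i) \<noteq> 0"
        "\<forall>i<?n. (\<Sum>j<?n. (if vs ! i \<rightarrow>\<^bsub>G\<^esub> vs ! j then 1 else 0) * f (vs ! j)) = x * f (vs ! i)"
      unfolding all ex sum_eq by blast
    define w where "w = vec ?n (\<lambda>i. f (vs ! i))"
    have w: "w \<in> carrier_vec ?n" by (simp add: w_def)
    have "w \<noteq> 0\<^sub>v ?n" using f(1) by (auto simp: w_def vec_eq_iff)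
    moreover have "adjacency_mat vs G *\<^sub>v w = x \<cdot>\<^sub>v w"
      using f(2) unfolding mv[OF w] by (simp add: w_def)
    ultimately show "eigenvalue (adjacency_mat vs G) x"
      using w by (auto simp: eigenvalue_def eigenvector_def adjacency_mat_def)
  qed
qed

lemma spectrum_adjacency_mat_nonempty:
  assumes G: "symmetric G" and vs: "vs \<noteq> []"
  shows "spectrum (adjacency_mat vs G) \<noteq> {}"
proof -
  let ?n = "length vs"
  let ?A = "adjacency_mat vs G"
  let ?B = "map_mat complex_of_real ?A"
  have A: "?A \<in> carrier_mat ?n ?n" and B: "?B \<in> carrier_mat ?n ?n"
    by (auto simp: adjacency_mat_def)
  obtain k where k: "eigenvalue ?B k"
    using spectrum_non_empty[OF B] vs by (auto simp: spectrum_def)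
  then obtain w where w: "w \<in> carrier_vec ?n" "w \<noteq> 0\<^sub>v ?n" "?B *\<^sub>v w = k \<cdot>\<^sub>v w"
    using B by (auto simp: eigenvalue_def eigenvector_def)
  define a where "a i j = ?A $$ (i, j)" for i j
  have a_sym: "a i j = a j i" if "i < ?n" "j < ?n" for i j
    using that G by (auto simp: a_def adjacency_mat_def symmetric_def dest: symD)
  have row: "(\<Sum>j<?n. complex_of_real (a i j) * w $ j) = k * w $ i" if "i < ?n" for i
  proof -
    have "(?B *\<^sub>v w) $ i = k * w $ i" using w that by simp
    moreover have "(?B *\<^sub>v w) $ i = (\<Sum>j<?n. complex_of_real (a i j) * w $ j)"
      using w(1) that A by (simp add: a_def scalar_prod_def atLeast0LessThan)
    ultimately show ?thesis by simp
  qed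
  define N where "N = (\<Sum>i<?n. cnj (w $ i) * w $ i)"
  define S where "S = (\<Sum>i<?n. \<Sum>j<?n. cnj (w $ i) * (complex_of_real (a i j) * w $ j))"
  have S: "S = k * N"
    unfolding S_def N_def sum_distrib_left
    by (rule sum.cong) (simp_all add: row flip: sum_distrib_left)
  have "cnj S = (\<Sum>i<?n. \<Sum>j<?n. w $ i * (complex_of_real (a i j) * cnj (w $ j)))"
    by (simp add: S_def)
  also have "\<dots> = (\<Sum>j<?n. \<Sum>i<?n. w $ i * (complex_of_real (a i j) * cnj (w $ j)))"
    by (rule sum.swap)
  also have "\<dots> = S"
    unfolding S_def by (intro sum.cong refl) (simp add: a_sym mult_ac)
  finally have cS: "cnj S = S" .
  have N: "N = complex_of_real (\<Sum>i<?n. (cmod (w $ i))\<^sup>2)"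
    unfolding N_def of_real_sum
    by (rule sum.cong[OF refl]) (metis complex_norm_square mult.commute)
  obtain i where i: "i < ?n" "w $ i \<noteq> 0" using w(1,2) by (auto simp: vec_eq_iff)
  have "(\<Sum>i<?n. (cmod (w $ i))\<^sup>2) > 0"
    by (rule sum_pos2[of _ i]) (use i in auto)
  then have "N \<noteq> 0" "cnj N = N" unfolding N of_real_eq_0_iff by auto
  then have "cnj k = k" using cS S by simp
  then obtain r where r: "k = complex_of_real r" by (metis Reals_cases Reals_cnj_iff)
  have "complex_of_real (poly (char_poly ?A) r) = poly (char_poly ?B) k"
    by (simp add: r of_real_hom.char_poly_hom[OF A])
  also have "\<dots> = 0" using k eigenvalue_root_char_poly[OF B] by simp
  finally show ?thesis
    using spectrum_root_char_poly[OF A] by auto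
qed

lemma
  assumes G: "graph G" and ne: "verts G \<noteq> {}"
    and vs: "distinct vs" "set vs = verts G"
  shows lambda1_eigenvalue: "eigenvalue (adjacency_mat vs G) (lambda1 G)"
    and lambda1_ge: "eigenvalue (adjacency_mat vs G) x \<Longrightarrow> x \<le> lambda1 G"
proof -
  define us where "us = (SOME us. distinct us \<and> set us = verts G)"
  have us: "distinct us" "set us = verts G"
    unfolding us_def using someI[of "\<lambda>us. distinct us \<and> set us = verts G" vs] vs by auto
  have "spectrum (adjacency_mat vs G) = spectrum (adjacency_mat us G)"
    by (simp add: set_eq_iff spectrum_def eigenvalue_adjacency_mat[OF vs] eigenvalue_adjacency_mat[OF us])
  then have eq: "lambda1 G = Max (spectrum (adjacency_mat vs G))"
    by (simp add: lambda1_def us_def)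
  have "adjacency_mat vs G \<in> carrier_mat (length vs) (length vs)"
    by (simp add: adjacency_mat_def)
  then have fin: "finite (spectrum (adjacency_mat vs G))"
    by (rule card_finite_spectrum)
  have "symmetric G"
    using G by (simp add: graph_def pseudo_graph_def sym_digraph_def sym_digraph_axioms_def)
  moreover have "vs \<noteq> []" using ne vs(2) by auto
  ultimately have "spectrum (adjacency_mat vs G) \<noteq> {}"
    by (rule spectrum_adjacency_mat_nonempty)
  with fin show "eigenvalue (adjacency_mat vs G) (lambda1 G)"
    using Max_in[of "spectrum (adjacency_mat vs G)"] by (simp add: eq spectrum_def)
  show "x \<le> lambda1 G" if "eigenvalue (adjacency_mat vs G) x"
    using Max_ge[OF fin, of x] that by (simp add: eq spectrum_def)
qed

end

theory Submission
  imports Defs "HOL-Analysis.Convex"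
begin

text \<open>Let \<open>q\<close> be the adjacency form of \<open>G\<close> at the absolute values of a top eigenvector. If \<open>G\<close> has
  at most \<open>n - 1\<close> edges, bipartiteness and the Cauchy-Schwarz inequality give \<open>\<lambda>\<^sup>2 \<le> n - 1\<close>; equality forces
  the edges to form a complete bipartite graph on all vertices, and since two vertices of the cube have at most two
  common neighbours, this is a star. Otherwise compress the vector and the vertex set in every
  coordinate direction, moving the larger of two values downwards. This does not decrease \<open>q\<close> or
  the number of edges, so one arrives at a down-set \<open>D\<close> with \<open>n\<close> members that contains a set with at least two elements. For
  bipartite graphs \<open>\<lambda>\<^sup>4\<close> is at most half the number of closed walks of length four. For a down-set this half
  number is \<open>\<Sum> u(S)\<^sup>2 + 5 \<Sum> |S| (|S| - 1)\<close>, where \<open>u(S)\<close> counts the one-element extensions of \<open>S\<close> in \<open>D\<close>,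
  and it is smaller than \<open>(n - 1)\<^sup>2\<close>. Here large sets are controlled by \<open>\<Sum> 3\<^bsup>|S|\<^esup> \<le> n\<^sup>2\<close>, which holds
  because \<open>3\<^bsup>|S|\<^esup>\<close> is the number of pairs \<open>(X, Y)\<close> with \<open>X \<union> Y = S\<close>.\<close>

section \<open>Adjacency in the cube\<close>

definition flip :: "'a \<Rightarrow> 'a set \<Rightarrow> 'a set" where
  "flip i S = (if i \<in> S then S - {i} else insert i S)"

text \<open>No ground set is fixed, so one relation serves all cubes \<open>Pow U\<close>; the
  restriction to a cube comes from the families that are summed over.\<close>

definition adj :: "'a set \<Rightarrow> 'a set \<Rightarrow> bool" where
  "adj S T \<longleftrightarrow> (\<exists>i. T = flip i S)"

lemma mem_flip_iff: "x \<in> flip i S \<longleftrightarrow> (x \<in> S) \<noteq> (x = i)"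
  by (auto simp: flip_def)

lemma flip_flip [simp]: "flip i (flip i S) = S"
  by (auto simp: set_eq_iff mem_flip_iff)

lemma flip_commute: "flip i (flip j S) = flip j (flip i S)"
  by (auto simp: set_eq_iff mem_flip_iff)

lemma flip_eq_iff [simp]: "flip i S = flip j S \<longleftrightarrow> i = j"
  by (auto simp: set_eq_iff mem_flip_iff)

lemma inj_flip: "inj_on (\<lambda>i. flip i S) A"
  by (simp add: inj_on_def)

lemma flip_in_Pow: "i \<in> U \<Longrightarrow> flip i S \<in> Pow U \<longleftrightarrow> S \<in> Pow U"
  by (auto simp: flip_def)

lemma adj_flip [simp]: "adj S (flip i S)"
  by (auto simp: adj_def)

lemma adj_sym: "adj S T \<longleftrightarrow> adj T S"
  unfolding adj_def by (metis flip_flip)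

lemma even_card_flip: "finite S \<Longrightarrow> even (card (flip i S)) \<longleftrightarrow> odd (card S)"
  by (auto simp: flip_def card_Diff_singleton dest: card_gt_0_iff[THEN iffD2, OF conjI[rotated]])

lemma adj_parity: "adj S T \<Longrightarrow> finite S \<Longrightarrow> even (card T) \<longleftrightarrow> odd (card S)"
  by (auto simp: adj_def even_card_flip)

text \<open>\<open>W\<close> arises from \<open>V\<close> by flipping \<open>i\<close> and some
  \<open>a\<close>, and also by flipping \<open>j\<close> and some \<open>b\<close>. As
  \<open>i\<close> and \<open>j\<close> differ, either the flips cancel (\<open>a = i\<close>) or
  the two pairs agree (\<open>a = j\<close>).\<close>

lemma common_neighbour:
  assumes "i \<noteq> j" "adj W (flip i V)" "adj W (flip j V)"
  shows "W = V \<or> W = flip i (flip j V)"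
proof -
  obtain a b where a: "W = flip a (flip i V)" and b: "W = flip b (flip j V)"
    using assms(2,3) unfolding adj_sym[of W] by (auto simp: adj_def)
  have "a = i \<or> a = j"
  proof (rule ccontr)
    assume *: "\<not> (a = i \<or> a = j)"
    have "i \<in> W \<longleftrightarrow> i \<notin> V" "j \<in> W \<longleftrightarrow> j \<in> V" "a \<in> W \<longleftrightarrow> a \<notin> V"
      using * assms(1) by (auto simp: a mem_flip_iff)
    moreover have "x \<in> W \<longleftrightarrow> ((x \<in> V) \<noteq> (x = j)) \<noteq> (x = b)" for x
      by (auto simp: b mem_flip_iff)
    ultimately show False using * assms(1) by metis
  qed
  then show ?thesis by (auto simp: a flip_commute)
qed

lemma card_offdiag:
  assumes "finite A"
  shows "real (card (A \<times> A - Id)) = real (card A) * (real (card A) - 1)"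
proof -
  let ?I = "(\<lambda>x. (x, x)) ` A"
  have "A \<times> A - Id = A \<times> A - ?I" by auto
  moreover have "card (A \<times> A - ?I) = card (A \<times> A) - card ?I"
    using assms by (intro card_Diff_subset) auto
  ultimately have "card (A \<times> A - Id) = card (A \<times> A) - card ?I" by simp
  also have "card ?I = card A" by (simp add: card_image inj_on_def)
  finally show ?thesis
    by (cases "card A") (auto simp: card_cartesian_product algebra_simps)
qed

section \<open>Down-sets\<close>

locale finite_downset =
  fixes D :: "'a set set"
  assumes fin: "finite D"
    and fin_elem: "S \<in> D \<Longrightarrow> finite S"
    and down: "S \<in> D \<Longrightarrow> T \<subseteq> S \<Longrightarrow> T \<in> D"
    and ne: "{} \<in> D"
begin

definition up :: "'a set \<Rightarrow> 'a set" where
  "up S = {i. i \<notin> S \<and> insert i S \<in> D}"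

text \<open>Ordered pairs, so each square of \<open>D\<close> with bottom \<open>S\<close> is
  recorded twice.\<close>

definition up_pairs :: "'a set \<Rightarrow> ('a \<times> 'a) set" where
  "up_pairs S = {(i, j). i \<noteq> j \<and> i \<notin> S \<and> j \<notin> S \<and> insert i (insert j S) \<in> D}"

lemma finite_Union: "finite (\<Union>D)"
  using fin fin_elem by blast

lemma finite_up [simp]: "finite (up S)"
  by (rule finite_subset[OF _ finite_Union]) (auto simp: up_def)

lemma up_pairs_subset: "up_pairs S \<subseteq> up S \<times> up S - Id"
  by (auto simp: up_pairs_def up_def intro: down)

lemma finite_up_pairs [simp]: "finite (up_pairs S)"
  by (rule finite_subset[OF up_pairs_subset]) simp

text \<open>Double count of the pairs \<open>S\<close>, \<open>insert i S\<close>, weighted by the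
  size of the lower set. The truncated \<open>card T - 1\<close> at \<open>T = {}\<close> is
  harmless because of the factor \<open>card T\<close>.\<close>

lemma sum_up:
  fixes g :: "nat \<Rightarrow> real"
  shows "(\<Sum>S\<in>D. real (card (up S)) * g (card S)) = (\<Sum>T\<in>D. real (card T) * g (card T - 1))"
proof -
  have "(\<Sum>S\<in>D. real (card (up S)) * g (card S)) = (\<Sum>S\<in>D. \<Sum>i\<in>up S. g (card S))" by simp
  also have "\<dots> = (\<Sum>(S,i)\<in>Sigma D up. g (card S))"
    using fin by (subst sum.Sigma) auto
  also have "\<dots> = (\<Sum>(T,i)\<in>Sigma D (\<lambda>T. T). g (card T - 1))"
    by (rule sum.reindex_bij_witness[where i = "\<lambda>(T,i). (T - {i}, i)" and j = "\<lambda>(S,i). (insert i S, i)"])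
      (auto simp: up_def insert_absorb fin_elem intro: down)
  also have "\<dots> = (\<Sum>T\<in>D. \<Sum>i\<in>T. g (card T - 1))"
    using fin fin_elem by (subst sum.Sigma) auto
  finally show ?thesis by simp
qed

text \<open>The same double count with an ordered pair of added elements; where
  \<open>card T - 2\<close> is truncated, the factor in front vanishes.\<close>

lemma sum_up_pairs:
  fixes g :: "nat \<Rightarrow> real"
  shows "(\<Sum>S\<in>D. real (card (up_pairs S)) * g (card S)) =
    (\<Sum>T\<in>D. real (card T) * (real (card T) - 1) * g (card T - 2))"
proof -
  have "(\<Sum>S\<in>D. real (card (up_pairs S)) * g (card S)) = (\<Sum>S\<in>D. \<Sum>p\<in>up_pairs S. g (card S))" by simp
  also have "\<dots> = (\<Sum>(S,p)\<in>Sigma D up_pairs. g (card S))"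
    using fin by (subst sum.Sigma) auto
  also have "\<dots> = (\<Sum>(T,p)\<in>Sigma D (\<lambda>T. T \<times> T - Id). g (card T - 2))"
    by (rule sum.reindex_bij_witness[where i = "\<lambda>(T,(i,j)). (T - {i,j}, (i,j))" and
          j = "\<lambda>(S,(i,j)). (insert i (insert j S), (i,j))"])
      (auto simp: up_pairs_def insert_absorb fin_elem insert_Diff_if intro: down)
  also have "\<dots> = (\<Sum>T\<in>D. \<Sum>p\<in>T \<times> T - Id. g (card T - 2))"
    using fin fin_elem by (subst sum.Sigma) auto
  finally show ?thesis by (simp add: card_offdiag fin_elem)
qed

end

text \<open>Every element of \<open>T\<close> lies in \<open>X\<close> only, in \<open>Y\<close>
  only or in both; the induction step splits the pairs for \<open>insert x T\<close> into these
  three copies.\<close>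

lemma card_union_eq:
  assumes "finite T"
  shows "card {(X, Y). X \<union> Y = T} = 3 ^ card T"
  using assms
proof (induction T)
  case (insert x T)
  let ?P = "{(X, Y). X \<union> Y = T}"
  have sub: "{(X, Y). X \<union> Y = S} \<subseteq> Pow S \<times> Pow S" for S :: "'a set" by auto
  have f: "finite ?P" by (rule finite_subset[OF sub]) (use insert in simp)
  let ?f = "\<lambda>(X, Y). (insert x X, Y)" and ?g = "\<lambda>(X, Y). (X, insert x Y)"
    and ?h = "\<lambda>(X, Y). (insert x X, insert x Y)"
  have nx: "x \<notin> X \<and> x \<notin> Y" if "(X, Y) \<in> ?P" for X Y using that insert by auto
  have eq: "{(X, Y). X \<union> Y = insert x T} = ?f ` ?P \<union> ?g ` ?P \<union> ?h ` ?P"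
  proof (intro equalityI subsetI)
    fix p assume p: "p \<in> {(X, Y). X \<union> Y = insert x T}"
    obtain X Y where XY: "p = (X, Y)" by fastforce
    have m: "(X - {x}, Y - {x}) \<in> ?P" using p XY insert by auto
    have "x \<in> X \<or> x \<in> Y" using p XY by auto
    then have "p = ?f (X - {x}, Y - {x}) \<or> p = ?g (X - {x}, Y - {x}) \<or> p = ?h (X - {x}, Y - {x})"
      by (auto simp: XY)
    then show "p \<in> ?f ` ?P \<union> ?g ` ?P \<union> ?h ` ?P" using m by blast
  qed auto
  have inj: "inj_on ?f ?P" "inj_on ?g ?P" "inj_on ?h ?P"
    by (auto simp: inj_on_def dest!: nx) (metis insert_ident insert.hyps(2) UnI1 UnI2)+
  have dis: "?f ` ?P \<inter> ?g ` ?P = {}" "(?f ` ?P \<union> ?g ` ?P) \<inter> ?h ` ?P = {}"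
    using insert.hyps(2) by auto
  show ?case
    unfolding eq using f insert by (simp add: card_Un_disjoint dis card_image inj)
qed (simp add: card_1_singleton_iff)

text \<open>The pointwise estimate behind the bound for many atoms. Equality at \<open>t = 3\<close>
  makes 24 the least possible constant.\<close>

lemma six_square_le_three_power:
  fixes t :: nat
  assumes "t \<ge> 3"
  shows "6 * real t ^ 2 - real t \<le> 3 ^ t + 24"
  using assms
proof (induction t rule: nat_induct_at_least)
  case (Suc t)
  \<comment> \<open>Three times the induction hypothesis leaves
    \<open>12 * t^2 - 14 * t - 53\<close> to be shown nonnegative; the product is smaller than that
    by 13.\<close>
  have "0 \<le> (real t - 3) * (12 * real t + 22)" using Suc.hyps by (intro mult_nonneg_nonneg) auto
  then show ?case using Suc by (simp add: power2_eq_square algebra_simps)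
qed simp

text \<open>The right-hand side is the chord in \<open>3 ^ t\<close> through \<open>t = 4\<close> and \<open>t = 5\<close>,
  chosen because for \<open>n = 103\<close> and at most 13 atoms the mean of \<open>3 ^ t\<close> over the big sets is at most 119.\<close>

lemma chord_bound:
  fixes t :: nat
  assumes "t \<ge> 2"
  shows "18 * (4 * real t ^ 2 + 9 * real t) \<le> 1395 + 5 * 3 ^ t"
proof -
  have ge5: "18 * (4 * real t ^ 2 + 9 * real t) \<le> 1395 + 5 * 3 ^ t" if "t \<ge> 5" for t :: nat
    using that
  proof (induction t rule: nat_induct_at_least)
    case (Suc t)
    have "0 \<le> (real t - 5) * (144 * real t + 700)" using Suc.hyps by (intro mult_nonneg_nonneg) auto
    then show ?case using Suc by (simp add: power2_eq_square algebra_simps)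
  qed simp
  consider "t = 2" | "t = 3" | "t = 4" | "t \<ge> 5" using assms by linarith
  then show ?thesis using ge5 by cases auto
qed

section \<open>Atoms, big members and the packing of ordered pairs\<close>

context finite_downset
begin

definition big :: "'a set set" where
  "big = {T \<in> D. card T \<ge> 2}"

definition small :: "'a set set" where
  "small = {T \<in> D. card T < 2}"

lemma finite_big [simp]: "finite big" and finite_small [simp]: "finite small"
  using fin by (auto simp: big_def small_def)

lemma small_eq: "small = insert {} ((\<lambda>i. {i}) ` up {})"
proof (intro equalityI subsetI)
  fix S assume S: "S \<in> small"
  have "finite S" using S by (simp add: small_def fin_elem)
  have "card S = 0 \<or> card S = 1" using S by (auto simp: small_def)
  then show "S \<in> insert {} ((\<lambda>i. {i}) ` up {})"
  proof
    assume "card S = 0"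
    then have "S = {}" using \<open>finite S\<close> by simp
    then show ?thesis by simp
  next
    assume "card S = 1"
    then obtain i where "S = {i}" by (rule card_1_singletonE)
    then show ?thesis using S by (auto simp: small_def up_def)
  qed
qed (auto simp: small_def up_def ne)

lemma card_small: "card small = 1 + card (up {})"
  unfolding small_eq by (subst card_insert_disjoint) (auto simp: card_image)

lemma small_Un_big: "small \<union> big = D" and small_Int_big: "small \<inter> big = {}"
  by (auto simp: big_def small_def)

lemma small_subset: "small \<subseteq> D"
  by (auto simp: small_def)

text \<open>With \<open>m\<close> atoms and \<open>r\<close> big members, the target
  \<open>(card D - 1)^2\<close> becomes \<open>m^2 + r * (r + 2 * m)\<close>, the form in which the
  energy is compared with it.\<close>

lemma card_D: "card D = 1 + card (up {}) + card big"
  using card_Un_disjoint[OF finite_small finite_big small_Int_big]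
  by (simp add: small_Un_big card_small)

text \<open>The indicator form over all of \<open>D\<close> is the one that \<open>sum_up\<close>
  and \<open>sum_up_pairs\<close> produce.\<close>

lemma sum_big: "(\<Sum>T\<in>big. h T) = (\<Sum>T\<in>D. of_bool (card T \<ge> 2) * h T)" for h :: "'a set \<Rightarrow> real"
  unfolding big_def sum.inter_filter[OF fin] by (rule sum.cong) auto

text \<open>Counting ordered pairs of members that are not both small yields the bound on the energy when
  there are many atoms. Three disjoint kinds of pairs occur: those whose union is a member,
  distinct one-element extensions of a common nonempty set, and an atom with a big set.\<close>

definition pair_region :: "('a set \<times> 'a set) set" where
  "pair_region = D \<times> D - small \<times> small"

definition union_pairs :: "('a set \<times> 'a set) set" where
  "union_pairs = {(X, Y) \<in> pair_region. X \<union> Y \<in> D}"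

lemma finite_pair_region [simp]: "finite pair_region"
  using fin by (simp add: pair_region_def)

lemma card_pair_region:
  "real (card pair_region) = real (card big) ^ 2 + 2 * real (card big) * (1 + real (card (up {})))"
proof -
  have "card pair_region = card (D \<times> D) - card (small \<times> small)"
    unfolding pair_region_def using small_subset by (intro card_Diff_subset) auto
  also have "\<dots> = (1 + card (up {}) + card big) ^ 2 - (1 + card (up {})) ^ 2"
    by (simp add: card_cartesian_product card_D card_small power2_eq_square)
  finally show ?thesis
    by (simp add: of_nat_diff power_mono) (simp add: power2_eq_square algebra_simps)
qed

text \<open>By \<open>card_union_eq\<close> the left side is the number of pairs whose union is big.
  Such a pair is in \<open>union_pairs\<close> unless both sets are small; then they are two
  distinct atoms, given by an element of \<open>up_pairs {}\<close>.\<close>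

lemma sum_three_power_le:
  "(\<Sum>T\<in>big. 3 ^ card T) \<le> real (card union_pairs) + real (card (up_pairs {}))"
proof -
  let ?U = "\<Union>T\<in>big. {(X, Y). X \<union> Y = T}"
  let ?V = "(\<lambda>(i, j). ({i}, {j})) ` up_pairs {}"
  have fT: "finite {(X, Y). X \<union> Y = T}" if "T \<in> big" for T
    by (rule finite_subset[of _ "Pow T \<times> Pow T"]) (use that in \<open>auto simp: big_def fin_elem\<close>)
  have "card ?U = (\<Sum>T\<in>big. card {(X, Y). X \<union> Y = T})"
    by (rule card_UN_disjoint) (use fT in auto)
  also have "\<dots> = (\<Sum>T\<in>big. 3 ^ card T)"
    by (rule sum.cong) (auto simp: big_def card_union_eq fin_elem)
  finally have "(\<Sum>T\<in>big. 3 ^ card T) = card ?U" by simp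
  moreover have "?U \<subseteq> union_pairs \<union> ?V"
  proof
    fix p assume "p \<in> ?U"
    then obtain X Y where p: "p = (X, Y)" and XY: "X \<union> Y \<in> big" by auto
    have D: "X \<in> D" "Y \<in> D" "X \<union> Y \<in> D" using XY by (auto simp: big_def intro: down)
    show "p \<in> union_pairs \<union> ?V"
    proof (cases "(X, Y) \<in> small \<times> small")
      case True
      have c: "card (X \<union> Y) \<ge> 2" using XY by (simp add: big_def)
      consider "X = {}" | "Y = {}" | i j where "X = {i}" "Y = {j}"
        using True by (auto simp: small_eq)
      then have "p \<in> ?V"
      proof cases
        case 3
        then have "i \<noteq> j" using c by auto
        then have "(i, j) \<in> up_pairs {}" using 3 D(3) by (auto simp: up_pairs_def insert_commute)
        then show ?thesis using 3 p by force
      qed (use c True in \<open>auto simp: small_def\<close>)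
      then show ?thesis by simp
    qed (use D p in \<open>auto simp: union_pairs_def pair_region_def\<close>)
  qed
  then have "card ?U \<le> card (union_pairs \<union> ?V)"
    by (rule card_mono[rotated]) (auto intro: finite_subset[OF _ finite_pair_region] simp: union_pairs_def)
  then have "card ?U \<le> card union_pairs + card (up_pairs {})"
    using card_Un_le[of union_pairs ?V] card_image_le[of "up_pairs {}" "\<lambda>(i, j). ({i}, {j})"]
    by force
  ultimately have "(\<Sum>T\<in>big. 3 ^ card T) \<le> card union_pairs + card (up_pairs {})" by simp
  then have "real (\<Sum>T\<in>big. 3 ^ card T) \<le> real (card union_pairs + card (up_pairs {}))"
    by (simp only: of_nat_le_iff)
  then show ?thesis by simp
qed

lemma subset_atoms: "S \<in> D \<Longrightarrow> S \<union> up S \<subseteq> up {}"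
  by (auto simp: up_def intro: down)

lemma card_up_diff:
  assumes "S \<in> D"
  shows "real (card (up {} - S - up S)) = real (card (up {})) - real (card S) - real (card (up S))"
proof -
  have "up {} - S - up S = up {} - (S \<union> up S)" by auto
  moreover have "card (S \<union> up S) = card S + card (up S)"
    using assms by (intro card_Un_disjoint fin_elem finite_up) (auto simp: up_def)
  moreover have "card (up {} - (S \<union> up S)) = card (up {}) - card (S \<union> up S)"
    using assms by (intro card_Diff_subset subset_atoms) (auto simp: fin_elem)
  moreover have "card (S \<union> up S) \<le> card (up {})"
    using assms by (intro card_mono subset_atoms) auto
  ultimately show ?thesis by (simp add: of_nat_diff)
qed

text \<open>The first sum counts pairs of extensions of a nonempty \<open>S\<close> whose union is
  not in \<open>D\<close>, the second an atom with a big \<open>Y\<close> to which it cannot be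
  added, doubled for the two orders.\<close>

lemma pair_packing:
  "real (card union_pairs)
    + (\<Sum>S\<in>D - {{}}. real (card (up S)) * (real (card (up S)) - 1) - real (card (up_pairs S)))
    + 2 * (\<Sum>Y\<in>big. real (card (up {})) - real (card Y) - real (card (up Y)))
   \<le> real (card pair_region)"
proof -
  \<comment> \<open>Only pairs whose union is not a member enter \<open>?I\<close> and \<open>?J\<close>, which keeps them
    disjoint from \<open>union_pairs\<close>.\<close>
  let ?I = "SIGMA S:D - {{}}. (up S \<times> up S - Id) - up_pairs S"
  let ?J = "SIGMA Y:big. up {} - Y - up Y"
  let ?b = "\<lambda>(S, (i, j)). (insert i S, insert j S)"
  let ?c = "\<lambda>(Y, i). ({i}, Y)" and ?d = "\<lambda>(Y, i). (Y, {i})"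
  have finI: "finite ?I" and finJ: "finite ?J" using fin by auto
  have I: "i \<notin> S \<and> j \<notin> S \<and> i \<noteq> j \<and> S \<noteq> {} \<and> S \<in> D \<and> insert i S \<in> D \<and> insert j S \<in> D
      \<and> insert i (insert j S) \<notin> D"
    if "(S, (i, j)) \<in> ?I" for S i j
    using that by (auto simp: up_def up_pairs_def)
  have J: "i \<notin> Y \<and> {i} \<in> D \<and> Y \<in> D \<and> card Y \<ge> 2 \<and> insert i Y \<notin> D"
    if "(Y, i) \<in> ?J" for Y i
    using that by (auto simp: up_def big_def)
  have inj_b: "inj_on ?b ?I"
  proof (rule inj_onI)
    fix p q assume p: "p \<in> ?I" and q: "q \<in> ?I" and eq: "?b p = ?b q"
    obtain S i j T k l where pq: "p = (S, (i, j))" "q = (T, (k, l))" by (metis prod.collapse)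
    have 1: "insert i S = insert k T" "insert j S = insert l T" using eq pq by auto
    \<comment> \<open>Two distinct extensions intersect in their base, so the pair determines
      \<open>S\<close>, and then \<open>i\<close> and \<open>j\<close>.\<close>
    have "S = insert i S \<inter> insert j S" "T = insert k T \<inter> insert l T"
      using I[of S i j] I[of T k l] p q pq by auto
    then have "S = T" using 1 by simp
    then show "p = q" using 1 I[of S i j] I[of T k l] p q pq by (metis insert_ident insertCI insertE)
  qed
  have inj_c: "inj_on ?c ?J" and inj_d: "inj_on ?d ?J" by (auto simp: inj_on_def)
  have "real (card (?b ` ?I)) = real (\<Sum>S\<in>D - {{}}. card ((up S \<times> up S - Id) - up_pairs S))"
    using fin by (subst card_image[OF inj_b]) (simp add: card_SigmaI)
  also have "\<dots> = (\<Sum>S\<in>D - {{}}. real (card (up S)) * (real (card (up S)) - 1) - real (card (up_pairs S)))"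
    unfolding of_nat_sum
  proof (rule sum.cong[OF refl])
    fix S
    have "card (up_pairs S) \<le> card (up S \<times> up S - Id)"
      by (intro card_mono up_pairs_subset) simp
    then show "real (card (up S \<times> up S - Id - up_pairs S)) =
        real (card (up S)) * (real (card (up S)) - 1) - real (card (up_pairs S))"
      by (simp add: card_Diff_subset up_pairs_subset of_nat_diff card_offdiag)
  qed
  finally have b: "real (card (?b ` ?I)) = (\<Sum>S\<in>D - {{}}. real (card (up S)) * (real (card (up S)) - 1) - real (card (up_pairs S)))" .
  have c0: "real (card ?J) = (\<Sum>Y\<in>big. real (card (up {})) - real (card Y) - real (card (up Y)))"
    by (simp add: card_SigmaI) (simp add: big_def card_up_diff)
  have c: "card (?c ` ?J) = card ?J" "card (?d ` ?J) = card ?J"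
    by (simp_all add: card_image inj_c inj_d)
  \<comment> \<open>The kinds of pairs are told apart by whether the union is a member and by which
    component is small. Both components are big here because \<open>S\<close> is nonempty.\<close>
  have b_props: "fst p \<in> D - small \<and> snd p \<in> D - small \<and> fst p \<union> snd p \<notin> D" if p: "p \<in> ?b ` ?I" for p
  proof -
    from p obtain q where q: "q \<in> ?I" "p = ?b q" by (rule imageE)
    obtain S i j where Sij: "q = (S, (i, j))" by (metis prod.collapse)
    note * = I[of S i j, OF q(1)[unfolded Sij]]
    then have "finite S" "card S > 0" using fin_elem by (auto simp: card_gt_0_iff)
    moreover have "insert i S \<union> insert j S = insert i (insert j S)" by auto
    ultimately show ?thesis using * by (simp add: q(2) Sij small_def)
  qed
  have c_props: "fst p \<in> small \<and> snd p \<in> D - small \<and> fst p \<union> snd p \<notin> D" if p: "p \<in> ?c ` ?J" for p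
  proof -
    from p obtain q where q: "q \<in> ?J" "p = ?c q" by (rule imageE)
    obtain Y i where Yi: "q = (Y, i)" by fastforce
    show ?thesis using J[of Y i, OF q(1)[unfolded Yi]] by (simp add: q(2) Yi small_def)
  qed
  have d_props: "snd p \<in> small \<and> fst p \<in> D - small \<and> fst p \<union> snd p \<notin> D" if p: "p \<in> ?d ` ?J" for p
  proof -
    from p obtain q where q: "q \<in> ?J" "p = ?d q" by (rule imageE)
    obtain Y i where Yi: "q = (Y, i)" by fastforce
    show ?thesis using J[of Y i, OF q(1)[unfolded Yi]] by (simp add: q(2) Yi small_def)
  qed
  have u_props: "fst p \<union> snd p \<in> D \<and> p \<in> pair_region" if "p \<in> union_pairs" for p
    using that by (auto simp: union_pairs_def)
  have region: "p \<in> pair_region \<longleftrightarrow> fst p \<in> D \<and> snd p \<in> D \<and> \<not> (fst p \<in> small \<and> snd p \<in> small)" for p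
    by (cases p) (simp add: pair_region_def)
  define B where "B = ?b ` ?I"
  define C where "C = ?c ` ?J"
  define E where "E = ?d ` ?J"
  note props = b_props[folded B_def] c_props[folded C_def] d_props[folded E_def] u_props
  have "p \<in> pair_region" if "p \<in> union_pairs \<union> B \<union> C \<union> E" for p
    using small_subset that props(1-3)[of p] props(4)[of p] unfolding region by blast
  then have sub: "union_pairs \<union> B \<union> C \<union> E \<subseteq> pair_region" by (rule subsetI)
  have d1: "union_pairs \<inter> B = {}"
    using props(1,4) by blast
  have d2: "(union_pairs \<union> B) \<inter> C = {}"
    using props(1,2,4) by blast
  have d3: "(union_pairs \<union> B \<union> C) \<inter> E = {}"
    using props by blast
  have fu: "finite union_pairs" by (rule finite_subset[OF _ finite_pair_region]) (auto simp: union_pairs_def)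
  have fB: "finite B" "finite C" "finite E"
    unfolding B_def C_def E_def by (rule finI[THEN finite_imageI] finJ[THEN finite_imageI])+
  have 1: "card (union_pairs \<union> B \<union> C \<union> E) = card union_pairs + card B + card C + card E"
    using fu fB by (simp only: card_Un_disjoint d1 d2 d3 finite_UnI)
  have 2: "card (union_pairs \<union> B \<union> C \<union> E) \<le> card pair_region"
    by (rule card_mono[OF finite_pair_region sub])
  have "real (card union_pairs) + real (card B) + 2 * real (card ?J) \<le> real (card pair_region)"
    using 1 2 unfolding c[folded C_def E_def] by linarith
  then have "real (card union_pairs) + real (card (?b ` ?I)) + 2 * real (card ?J) \<le> real (card pair_region)"
    unfolding B_def .
  then show ?thesis unfolding b c0 .
qed

end

section \<open>The number of closed walks of length four\<close>

context finite_downset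
begin

text \<open>Half the number of closed walks of length four, expressed through the sizes and up-degrees
  of the members of the down-set.\<close>

definition energy :: real where
  "energy = (\<Sum>S\<in>D. real (card (up S)) ^ 2) + 5 * (\<Sum>S\<in>D. real (card S) * (real (card S) - 1))"

text \<open>The part of the squared up-degrees of nonempty sets left after
  \<open>u^2 = u * (u - 1) + u\<close>. It counts ordered pairs of distinct extensions, which is
  what the packing controls.\<close>

definition excess :: real where
  "excess = (\<Sum>S\<in>D - {{}}. real (card (up S)) * (real (card (up S)) - 1))"

lemma sum_nonempty:
  "(\<Sum>S\<in>D - {{}}. h S) = (\<Sum>S\<in>D. of_bool (card S > 0) * h S)" for h :: "'a set \<Rightarrow> real"
proof -
  have "(\<Sum>S\<in>D - {{}}. h S) = (\<Sum>S\<in>D - {{}}. of_bool (card S > 0) * h S)"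
    by (rule sum.cong) (auto simp: card_gt_0_iff fin_elem)
  also have "\<dots> = (\<Sum>S\<in>D. of_bool (card S > 0) * h S)"
    by (rule sum.mono_neutral_left) (use fin in auto)
  finally show ?thesis .
qed

text \<open>The empty set contributes the square of the number of atoms. By \<open>sum_up\<close>
  the linear part of the other up-degrees becomes the sum of \<open>t = card T\<close> over big
  sets, and \<open>t + 5 * t * (t - 1) = 5 * t^2 - 4 * t\<close>.\<close>

lemma energy_eq:
  "energy = real (card (up {})) ^ 2 + excess + (\<Sum>T\<in>big. 5 * real (card T) ^ 2 - 4 * real (card T))"
proof -
  let ?u = "\<lambda>S. real (card (up S))" and ?s = "\<lambda>S. real (card S)"
  have "(\<Sum>S\<in>D. ?u S ^ 2) = ?u {} ^ 2 + (\<Sum>S\<in>D - {{}}. ?u S ^ 2)"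
    by (rule sum.remove[OF fin ne])
  also have "(\<Sum>S\<in>D - {{}}. ?u S ^ 2) = excess + (\<Sum>S\<in>D - {{}}. ?u S)"
    unfolding excess_def sum.distrib[symmetric] by (simp add: power2_eq_square algebra_simps)
  also have "(\<Sum>S\<in>D - {{}}. ?u S) = (\<Sum>S\<in>D. ?u S * of_bool (card S > 0))"
    by (simp only: sum_nonempty mult.commute)
  also have "\<dots> = (\<Sum>T\<in>D. ?s T * of_bool (card T - 1 > 0))"
    by (rule sum_up)
  finally have "energy = ?u {} ^ 2 + excess +
      ((\<Sum>T\<in>D. ?s T * of_bool (card T - 1 > 0)) + (\<Sum>S\<in>D. 5 * (?s S * (?s S - 1))))"
    by (simp add: energy_def sum_distrib_left)
  also have "(\<Sum>T\<in>D. ?s T * of_bool (card T - 1 > 0)) + (\<Sum>S\<in>D. 5 * (?s S * (?s S - 1))) =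
      (\<Sum>T\<in>big. 5 * ?s T ^ 2 - 4 * ?s T)"
    unfolding sum_big sum.distrib[symmetric]
  proof (rule sum.cong[OF refl])
    fix T assume "T \<in> D"
    consider "card T = 0" | "card T = 1" | "card T \<ge> 2" by linarith
    then show "?s T * of_bool (card T - 1 > 0) + 5 * (?s T * (?s T - 1)) =
        of_bool (2 \<le> card T) * (5 * ?s T ^ 2 - 4 * ?s T)"
      by cases (auto simp: power2_eq_square algebra_simps)
  qed
  finally show ?thesis .
qed

lemma card_up_pairs_empty: "real (card (up_pairs {})) = (\<Sum>T\<in>big. 2 * of_bool (card T = 2))"
proof -
  \<comment> \<open>The indicator of size 0 as weight in \<open>sum_up_pairs\<close> selects the
    empty set. On the other side sizes 0 and 1 pass the truncated test but carry the factor 0, so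
    only two-element sets remain.\<close>
  have "(\<Sum>S\<in>D. real (card (up_pairs S)) * of_bool (card S = 0)) = real (card (up_pairs {}))"
  proof -
    have "(\<Sum>S\<in>D. real (card (up_pairs S)) * of_bool (card S = 0)) =
        (\<Sum>S\<in>D. if S = {} then real (card (up_pairs {})) else 0)"
      by (rule sum.cong) (auto simp: fin_elem)
    then show ?thesis using fin ne by simp
  qed
  moreover have "(\<Sum>S\<in>D. real (card (up_pairs S)) * of_bool (card S = 0)) =
      (\<Sum>T\<in>D. real (card T) * (real (card T) - 1) * of_bool (card T - 2 = 0))"
    by (rule sum_up_pairs)
  moreover have "\<dots> = (\<Sum>T\<in>big. 2 * of_bool (card T = 2))"
    unfolding sum_big
  proof (rule sum.cong[OF refl])
    fix T
    consider "card T = 0" | "card T = 1" | "card T = 2" | "card T > 2" by linarith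
    then show "real (card T) * (real (card T) - 1) * of_bool (card T - 2 = 0) =
        of_bool (2 \<le> card T) * (2 * of_bool (card T = 2))" by cases auto
  qed
  ultimately show ?thesis by simp
qed

text \<open>Eliminating \<open>excess\<close> by \<open>pair_packing\<close> and
  \<open>union_pairs\<close> by \<open>sum_three_power_le\<close> cancels the mixed term
  \<open>2 * r * m\<close>. What remains is \<open>m^2 + r^2 + 2 * r\<close> and a sum over big sets
  with summands at most 24.\<close>

lemma energy_le_many_atoms:
  "energy \<le> real (card (up {})) ^ 2 + real (card big) ^ 2 + 26 * real (card big)"
proof -
  let ?u = "\<lambda>S. real (card (up S))" and ?s = "\<lambda>S. real (card S)"
  let ?r = "real (card big)"
  have 1: "(\<Sum>S\<in>D - {{}}. ?u S * (?u S - 1) - real (card (up_pairs S))) =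
      excess - (\<Sum>T\<in>big. ?s T * (?s T - 1) * of_bool (card T > 2))"
  proof -
    have "(\<Sum>S\<in>D - {{}}. real (card (up_pairs S))) =
        (\<Sum>S\<in>D. real (card (up_pairs S)) * of_bool (card S > 0))"
      by (simp only: sum_nonempty mult.commute)
    also have "\<dots> = (\<Sum>T\<in>D. ?s T * (?s T - 1) * of_bool (card T - 2 > 0))"
      by (rule sum_up_pairs)
    also have "\<dots> = (\<Sum>T\<in>big. ?s T * (?s T - 1) * of_bool (card T > 2))"
      unfolding sum_big by (rule sum.cong) auto
    finally show ?thesis by (simp add: sum_subtractf excess_def)
  qed
  have 2: "(\<Sum>Y\<in>big. ?u {} - ?s Y - ?u Y) =
      ?r * ?u {} - (\<Sum>T\<in>big. ?s T) - (\<Sum>T\<in>big. ?s T * of_bool (card T > 2))"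
  proof -
    have "(\<Sum>Y\<in>big. ?u Y) = (\<Sum>S\<in>D. ?u S * of_bool (card S \<ge> 2))"
      by (simp only: sum_big mult.commute)
    also have "\<dots> = (\<Sum>T\<in>D. ?s T * of_bool (card T - 1 \<ge> 2))"
      by (rule sum_up)
    also have "\<dots> = (\<Sum>T\<in>big. ?s T * of_bool (card T > 2))"
      unfolding sum_big by (rule sum.cong) auto
    finally show ?thesis by (simp add: sum_subtractf)
  qed
  \<comment> \<open>For \<open>t = card T\<close> at least 3 the left side collapses to
    \<open>6 * t^2 - t - 3^t\<close>; for \<open>t = 2\<close> it equals 9.\<close>
  have pt: "5 * ?s T ^ 2 - 4 * ?s T - 3 ^ card T + 2 * of_bool (card T = 2)
      + ?s T * (?s T - 1) * of_bool (card T > 2) + 2 * ?s T + 2 * (?s T * of_bool (card T > 2)) \<le> 24"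
    if "T \<in> big" for T
  proof -
    have "card T \<ge> 2" using that by (simp add: big_def)
    then consider "card T = 2" | "card T \<ge> 3" by linarith
    then show ?thesis
    proof cases
      case 2
      then show ?thesis using six_square_le_three_power[of "card T"]
        by (simp add: power2_eq_square algebra_simps)
    qed simp
  qed
  have "(\<Sum>T\<in>big. 5 * ?s T ^ 2 - 4 * ?s T) - (\<Sum>T\<in>big. 3 ^ card T) + (\<Sum>T\<in>big. 2 * of_bool (card T = 2))
      + (\<Sum>T\<in>big. ?s T * (?s T - 1) * of_bool (card T > 2)) + 2 * (\<Sum>T\<in>big. ?s T)
      + 2 * (\<Sum>T\<in>big. ?s T * of_bool (card T > 2)) =
    (\<Sum>T\<in>big. 5 * ?s T ^ 2 - 4 * ?s T - 3 ^ card T + 2 * of_bool (card T = 2)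
      + ?s T * (?s T - 1) * of_bool (card T > 2) + 2 * ?s T + 2 * (?s T * of_bool (card T > 2)))"
    by (simp only: sum.distrib sum_subtractf sum_distrib_left)
  also have "\<dots> \<le> ?r * 24"
    by (rule sum_bounded_above[OF pt])
  finally have "(\<Sum>T\<in>big. 5 * ?s T ^ 2 - 4 * ?s T) - (\<Sum>T\<in>big. 3 ^ card T) + (\<Sum>T\<in>big. 2 * of_bool (card T = 2))
      + (\<Sum>T\<in>big. ?s T * (?s T - 1) * of_bool (card T > 2)) + 2 * (\<Sum>T\<in>big. ?s T)
      + 2 * (\<Sum>T\<in>big. ?s T * of_bool (card T > 2)) \<le> 24 * ?r" by simp
  then show ?thesis
    using energy_eq sum_three_power_le pair_packing card_up_pairs_empty
    unfolding 1 2 card_pair_region power2_eq_square[of ?r] by (simp only: algebra_simps)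
qed

text \<open>Since \<open>S\<close> and \<open>up S\<close> are disjoint sets of atoms, the up-degree
  is at most \<open>m - card S\<close>, which turns \<open>excess\<close> into a sum of
  \<open>t * (m - t)\<close> over big sets. \<open>chord_bound\<close> trades the resulting
  quadratic for \<open>3^t\<close>, whose sum is limited by the number of pairs.\<close>

lemma energy_less_few_atoms:
  assumes "card (up {}) \<le> 13" "card D \<ge> 103"
  shows "energy < (real (card D) - 1) ^ 2"
proof -
  let ?u = "\<lambda>S. real (card (up S))" and ?s = "\<lambda>S. real (card S)"
  let ?r = "real (card big)" and ?m = "real (card (up {}))"
  have "excess \<le> (\<Sum>S\<in>D - {{}}. ?u S * (?m - ?s S - 1))"
    unfolding excess_def
  proof (rule sum_mono)
    fix S assume "S \<in> D - {{}}"
    then have "?u S \<le> ?m - ?s S" using card_up_diff[of S] by auto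
    then show "?u S * (?u S - 1) \<le> ?u S * (?m - ?s S - 1)" by (intro mult_left_mono) auto
  qed
  also have "\<dots> = (\<Sum>S\<in>D. ?u S * (of_bool (card S > 0) * (?m - ?s S - 1)))"
    unfolding sum_nonempty by (rule sum.cong) auto
  also have "\<dots> = (\<Sum>T\<in>D. ?s T * (of_bool (card T - 1 > 0) * (?m - real (card T - 1) - 1)))"
    by (rule sum_up)
  also have "\<dots> = (\<Sum>T\<in>big. ?s T * (?m - ?s T))"
    unfolding sum_big by (rule sum.cong) (auto simp: of_nat_diff)
  finally have ex: "excess \<le> (\<Sum>T\<in>big. ?s T * (?m - ?s T))" .
  have "18 * ((\<Sum>T\<in>big. ?s T * (?m - ?s T)) + (\<Sum>T\<in>big. 5 * ?s T ^ 2 - 4 * ?s T))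
      = (\<Sum>T\<in>big. 18 * (?s T * (?m - ?s T) + (5 * ?s T ^ 2 - 4 * ?s T)))"
    unfolding sum.distrib[symmetric] by (rule sum_distrib_left)
  also have "\<dots> \<le> (\<Sum>T\<in>big. 1395 + 5 * 3 ^ card T - 36 * (13 - ?m))"
  proof (rule sum_mono)
    fix T assume "T \<in> big"
    then have t: "card T \<ge> 2" by (simp add: big_def)
    \<comment> \<open>\<open>chord_bound\<close> is the case \<open>m = 13\<close>; a smaller
      \<open>m\<close> saves \<open>18 * t * (13 - m)\<close>, which is at least
      \<open>36 * (13 - m)\<close>.\<close>
    have "0 \<le> (?s T - 2) * (13 - ?m)" using t assms(1) by (intro mult_nonneg_nonneg) auto
    then show "18 * (?s T * (?m - ?s T) + (5 * ?s T ^ 2 - 4 * ?s T)) \<le> 1395 + 5 * 3 ^ card T - 36 * (13 - ?m)"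
      using chord_bound[OF t] by (simp add: power2_eq_square algebra_simps)
  qed
  also have "\<dots> = (1395 - 36 * (13 - ?m)) * ?r + 5 * (\<Sum>T\<in>big. 3 ^ card T)"
    by (simp add: sum.distrib sum_subtractf sum_distrib_left algebra_simps)
  finally have 1: "18 * (energy - ?m ^ 2) \<le> (1395 - 36 * (13 - ?m)) * ?r + 5 * (\<Sum>T\<in>big. 3 ^ card T)"
    using ex energy_eq by simp
  have "card union_pairs \<le> card pair_region"
    by (rule card_mono) (auto simp: union_pairs_def)
  moreover have "real (card (up_pairs {})) \<le> (\<Sum>T\<in>big. 2)"
    unfolding card_up_pairs_empty by (rule sum_mono) auto
  ultimately have "(\<Sum>T\<in>big. 3 ^ card T) \<le> ?r ^ 2 + 2 * ?r * (1 + ?m) + 2 * ?r"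
    using sum_three_power_le card_pair_region by simp
  then have 2: "18 * (energy - ?m ^ 2) \<le> ?r * (1415 - 36 * (13 - ?m) + 5 * (?r + 2 * ?m))"
    using 1 by (simp add: power2_eq_square algebra_simps)
  have n: "real (card D) = 1 + ?m + ?r" using card_D by simp
  have r: "?r > 0" and big: "?r + 2 * ?m \<ge> 102 + ?m" using card_D assms by linarith+
  \<comment> \<open>With \<open>X = r + 2 * m\<close> this says
    \<open>947 + 36 * m < 13 * X\<close>; by \<open>X >= 102 + m\<close> the slack is at least
    \<open>379 - 23 * m\<close>, positive for \<open>m <= 13\<close>.\<close>
  have "1415 - 36 * (13 - ?m) + 5 * (?r + 2 * ?m) < 18 * (?r + 2 * ?m)"
    using big assms(1)[folded of_nat_le_iff[where 'a = real]] by simp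
  then have "?r * (1415 - 36 * (13 - ?m) + 5 * (?r + 2 * ?m)) < ?r * (18 * (?r + 2 * ?m))"
    using r by (intro mult_strict_left_mono)
  then have "energy - ?m ^ 2 < ?r * (?r + 2 * ?m)" using 2 by (simp add: algebra_simps)
  then show ?thesis unfolding n by (simp add: power2_eq_square algebra_simps)
qed

text \<open>The bound for many atoms suffices once \<open>26 < 2 * m\<close>, hence the split at
  13.\<close>

lemma energy_less:
  assumes "card D \<ge> 103" "big \<noteq> {}"
  shows "energy < (real (card D) - 1) ^ 2"
proof (cases "card (up {}) \<le> 13")
  case False
  let ?r = "real (card big)" and ?m = "real (card (up {}))"
  have r: "?r > 0" using assms(2) finite_big by (simp add: card_gt_0_iff)
  have "?r * 26 < ?r * (2 * ?m)" using r False by (intro mult_strict_left_mono) auto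
  moreover have n: "real (card D) = 1 + ?m + ?r" using card_D by simp
  ultimately show ?thesis
    using energy_le_many_atoms unfolding n by (simp add: power2_eq_square algebra_simps)
qed (rule energy_less_few_atoms[OF _ assms(1)])

section \<open>Degrees and codegrees in a down-set\<close>

definition nb :: "'a set \<Rightarrow> 'a set" where
  "nb S = {i. flip i S \<in> D}"

lemma nb_eq: "S \<in> D \<Longrightarrow> nb S = S \<union> up S"
  by (auto simp: nb_def up_def flip_def intro: down)

lemma finite_nb: "S \<in> D \<Longrightarrow> finite (nb S)"
  by (simp add: nb_eq fin_elem)

lemma card_nb: "S \<in> D \<Longrightarrow> card (nb S) = card S + card (up S)"
  by (simp add: nb_eq, subst card_Un_disjoint) (auto simp: fin_elem up_def[symmetric], auto simp: up_def)

lemma sum_adj: "(\<Sum>T\<in>D. of_bool (adj S T) * h T) = (\<Sum>i\<in>nb S. h (flip i S))" for h :: "'a set \<Rightarrow> real"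
proof -
  have "(\<Sum>T\<in>D. of_bool (adj S T) * h T) = (\<Sum>T\<in>{T\<in>D. adj S T}. h T)"
    unfolding sum.inter_filter[OF fin] by (rule sum.cong) auto
  also have "{T\<in>D. adj S T} = (\<lambda>i. flip i S) ` nb S" by (auto simp: adj_def nb_def)
  also have "(\<Sum>T\<in>\<dots>. h T) = (\<Sum>i\<in>nb S. h (flip i S))"
    by (subst sum.reindex[OF inj_flip]) simp
  finally show ?thesis .
qed

text \<open>The entries of the squared adjacency matrix of \<open>D\<close>; their squares sum to
  the number of closed walks of length four.\<close>

definition codeg :: "'a set \<Rightarrow> 'a set \<Rightarrow> real" where
  "codeg S T = (\<Sum>V\<in>D. of_bool (adj V S) * of_bool (adj V T))"

lemma codeg_self: "codeg S S = real (card (nb S))"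
proof -
  have "codeg S S = (\<Sum>V\<in>D. of_bool (adj S V) * 1)"
    unfolding codeg_def by (rule sum.cong) (auto simp: adj_sym)
  then show ?thesis unfolding sum_adj by simp
qed

text \<open>\<open>V\<close> accounts for the 1; by \<open>common_neighbour\<close> the only other
  candidate is the opposite corner of the square.\<close>

lemma codeg_le:
  assumes "i \<noteq> j" "V \<in> D"
  shows "codeg (flip i V) (flip j V) \<le> 1 + of_bool (flip i (flip j V) \<in> D)"
proof -
  let ?W = "flip i (flip j V)"
  have ne: "?W \<noteq> V" using assms(1) by (auto simp: set_eq_iff mem_flip_iff)
  have "codeg (flip i V) (flip j V) \<le> (\<Sum>W\<in>D. of_bool (W = V) + of_bool (W = ?W))"
    unfolding codeg_def
    by (rule sum_mono) (use common_neighbour[OF assms(1)] in \<open>auto simp: of_bool_def\<close>)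
  also have "\<dots> = 1 + of_bool (?W \<in> D)"
    using fin assms(2) by (simp add: sum.distrib of_bool_def)
  finally show ?thesis .
qed

text \<open>The diagonal terms are degrees. Off the diagonal each term is at most 2, and at most 1
  for two upward directions whose square has its top outside \<open>D\<close>, the set
  \<open>?X\<close> of the proof.\<close>

lemma sum_codeg_nb_le:
  assumes V: "V \<in> D"
  shows "(\<Sum>i\<in>nb V. \<Sum>j\<in>nb V. codeg (flip i V) (flip j V)) \<le>
    (\<Sum>i\<in>nb V. real (card (nb (flip i V)))) + 2 * (real (card (nb V)) * (real (card (nb V)) - 1))
    - (real (card (up V)) * (real (card (up V)) - 1) - real (card (up_pairs V)))"
proof -
  let ?N = "nb V \<times> nb V - Id" and ?I = "(\<lambda>i. (i, i)) ` nb V"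
  let ?c = "\<lambda>(i, j). codeg (flip i V) (flip j V)"
  let ?X = "up V \<times> up V - Id - up_pairs V"
  have fN: "finite ?N" using finite_nb[OF V] by simp
  have "(\<Sum>i\<in>nb V. \<Sum>j\<in>nb V. codeg (flip i V) (flip j V)) = sum ?c (nb V \<times> nb V)"
    by (simp add: sum.cartesian_product)
  also have "nb V \<times> nb V = ?I \<union> ?N" by auto
  also have "sum ?c \<dots> = sum ?c ?I + sum ?c ?N"
    by (rule sum.union_disjoint) (use finite_nb[OF V] in auto)
  also have "sum ?c ?I = (\<Sum>i\<in>nb V. real (card (nb (flip i V))))"
    by (subst sum.reindex) (auto simp: inj_on_def codeg_self)
  also have "sum ?c ?N \<le> (\<Sum>p\<in>?N. 2 - of_bool (p \<in> ?X))"
  proof (rule sum_mono)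
    fix p assume p: "p \<in> ?N"
    obtain i j where ij: "p = (i, j)" by fastforce
    have "i \<noteq> j" using p ij by auto
    note le = codeg_le[OF this V]
    show "?c p \<le> 2 - of_bool (p \<in> ?X)"
    proof (cases "p \<in> ?X")
      case True
      then have "flip i (flip j V) \<notin> D" using \<open>i \<noteq> j\<close> by (auto simp: ij up_def up_pairs_def flip_def)
      then show ?thesis using le True ij by simp
    next
      case False
      then show ?thesis using le ij by (auto simp: of_bool_def split: if_splits)
    qed
  qed
  also have "\<dots> = 2 * real (card ?N) - real (card (?N \<inter> {p. p \<in> ?X}))"
    unfolding sum_subtractf using fN by (subst sum_of_bool_eq) auto
  also have "?N \<inter> {p. p \<in> ?X} = ?X" using V by (auto simp: nb_eq)
  also have "real (card ?X) = real (card (up V)) * (real (card (up V)) - 1) - real (card (up_pairs V))"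
    using card_mono[OF _ up_pairs_subset[of V]]
    by (simp add: card_Diff_subset up_pairs_subset of_nat_diff card_offdiag)
  finally show ?thesis using card_offdiag[OF finite_nb[OF V]] by simp
qed

text \<open>One factor of each square is expanded over the midpoint \<open>V\<close> of a path from
  \<open>S\<close> to \<open>T\<close>, and the sums are exchanged so that \<open>V\<close> is
  outermost. Splitting degrees as \<open>card S + card (up S)\<close> and double counting then
  removes the mixed terms.\<close>

lemma sum_codeg_square_le: "(\<Sum>S\<in>D. \<Sum>T\<in>D. codeg S T ^ 2) \<le> 2 * energy"
proof -
  let ?u = "\<lambda>S. real (card (up S))" and ?s = "\<lambda>S. real (card S)" and ?d = "\<lambda>S. real (card (nb S))"
  let ?a = "\<lambda>S T. of_bool (adj S T) :: real"
  have "(\<Sum>S\<in>D. \<Sum>T\<in>D. codeg S T ^ 2) = (\<Sum>S\<in>D. \<Sum>T\<in>D. \<Sum>V\<in>D. ?a V S * ?a V T * codeg S T)"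
    by (simp add: codeg_def power2_eq_square sum_distrib_right)
  also have "\<dots> = (\<Sum>S\<in>D. \<Sum>V\<in>D. \<Sum>T\<in>D. ?a V S * ?a V T * codeg S T)"
    by (rule sum.cong[OF refl]) (rule sum.swap)
  also have "\<dots> = (\<Sum>V\<in>D. \<Sum>S\<in>D. \<Sum>T\<in>D. ?a V S * ?a V T * codeg S T)"
    by (rule sum.swap)
  also have "\<dots> = (\<Sum>V\<in>D. \<Sum>S\<in>D. ?a V S * (\<Sum>T\<in>D. ?a V T * codeg S T))"
    by (simp add: sum_distrib_left mult.assoc)
  also have "\<dots> = (\<Sum>V\<in>D. \<Sum>i\<in>nb V. \<Sum>j\<in>nb V. codeg (flip i V) (flip j V))"
    by (simp add: sum_adj)
  also have "\<dots> \<le> (\<Sum>V\<in>D. (\<Sum>i\<in>nb V. ?d (flip i V)) + 2 * (?d V * (?d V - 1))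
      - (?u V * (?u V - 1) - real (card (up_pairs V))))"
    by (rule sum_mono) (rule sum_codeg_nb_le)
  also have "\<dots> = (\<Sum>V\<in>D. \<Sum>i\<in>nb V. ?d (flip i V)) + (\<Sum>V\<in>D. 2 * (?d V * (?d V - 1)) - ?u V * (?u V - 1))
      + (\<Sum>V\<in>D. real (card (up_pairs V)) * 1)"
    by (simp add: sum.distrib sum_subtractf)
  also have "(\<Sum>V\<in>D. real (card (up_pairs V)) * 1) = (\<Sum>T\<in>D. ?s T * (?s T - 1) * 1)"
    by (rule sum_up_pairs)
  also have "(\<Sum>V\<in>D. \<Sum>i\<in>nb V. ?d (flip i V)) = (\<Sum>V\<in>D. \<Sum>T\<in>D. ?a V T * ?d T)"
    by (simp add: sum_adj)
  also have "\<dots> = (\<Sum>T\<in>D. \<Sum>V\<in>D. ?a V T * ?d T)" by (rule sum.swap)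
  also have "\<dots> = (\<Sum>T\<in>D. \<Sum>V\<in>D. ?a T V * ?d T)" by (simp only: adj_sym)
  also have "\<dots> = (\<Sum>T\<in>D. ?d T ^ 2)" by (simp add: sum_adj power2_eq_square)
  also have "(\<Sum>T\<in>D. ?d T ^ 2) + (\<Sum>V\<in>D. 2 * (?d V * (?d V - 1)) - ?u V * (?u V - 1))
      + (\<Sum>T\<in>D. ?s T * (?s T - 1) * 1) =
      (\<Sum>V\<in>D. ?d V ^ 2 + (2 * (?d V * (?d V - 1)) - ?u V * (?u V - 1)) + ?s V * (?s V - 1) * 1)"
    by (simp only: sum.distrib)
  also have "\<dots> = (\<Sum>V\<in>D. 2 * ?u V ^ 2 + 6 * (?u V * ?s V) + 4 * ?s V ^ 2 - ?u V * 1 - 3 * ?s V)"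
    by (rule sum.cong) (auto simp: card_nb power2_eq_square algebra_simps)
  also have "\<dots> = 2 * (\<Sum>V\<in>D. ?u V ^ 2) + 6 * (\<Sum>V\<in>D. ?u V * ?s V) + (\<Sum>V\<in>D. 4 * ?s V ^ 2 - 3 * ?s V)
      - (\<Sum>V\<in>D. ?u V * 1)"
    by (simp add: sum.distrib sum_subtractf sum_distrib_left)
  also have "(\<Sum>V\<in>D. ?u V * ?s V) = (\<Sum>T\<in>D. ?s T * real (card T - 1))"
    by (rule sum_up)
  also have "(\<Sum>V\<in>D. ?u V * 1) = (\<Sum>T\<in>D. ?s T * 1)"
    by (rule sum_up)
  also have "2 * (\<Sum>V\<in>D. ?u V ^ 2) + 6 * (\<Sum>T\<in>D. ?s T * real (card T - 1)) + (\<Sum>V\<in>D. 4 * ?s V ^ 2 - 3 * ?s V)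
      - (\<Sum>T\<in>D. ?s T * 1) = 2 * (\<Sum>V\<in>D. ?u V ^ 2) +
      (\<Sum>T\<in>D. 6 * (?s T * real (card T - 1)) + (4 * ?s T ^ 2 - 3 * ?s T) - ?s T * 1)"
    by (simp only: sum.distrib sum_subtractf sum_distrib_left)
  also have "\<dots> = 2 * (\<Sum>V\<in>D. ?u V ^ 2) + (\<Sum>T\<in>D. 10 * (?s T * (?s T - 1)))"
  proof -
    have "6 * (?s T * real (card T - 1)) + (4 * ?s T ^ 2 - 3 * ?s T) - ?s T * 1 = 10 * (?s T * (?s T - 1))" for T :: "'a set"
      by (cases "card T") (auto simp: power2_eq_square algebra_simps)
    then show ?thesis by simp
  qed
  also have "\<dots> = 2 * energy" by (simp add: energy_def sum_distrib_left)
  finally show ?thesis .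
qed

end

section \<open>Compression\<close>

text \<open>The quadratic form of the adjacency matrix of the cube on \<open>U\<close>, with each
  edge taken in both directions. Induced subgraphs enter through functions that vanish off their
  vertices.\<close>

definition cube_form :: "'a set \<Rightarrow> ('a set \<Rightarrow> real) \<Rightarrow> real" where
  "cube_form U f = (\<Sum>S\<in>Pow U. \<Sum>i\<in>U. f S * f (flip i S))"

definition compress :: "'a \<Rightarrow> ('a set \<Rightarrow> real) \<Rightarrow> 'a set \<Rightarrow> real" where
  "compress j f S = (if j \<in> S then min (f S) (f (flip j S)) else max (f S) (f (flip j S)))"

definition compress_set :: "'a \<Rightarrow> 'a set set \<Rightarrow> 'a set set" where
  "compress_set j G = {S. if j \<in> S then S \<in> G \<and> flip j S \<in> G else S \<in> G \<or> flip j S \<in> G}"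

text \<open>Compressing a family is compressing its indicator, so the statements on functions also
  cover cardinalities and edge numbers.\<close>

lemma compress_indicator:
  "compress j (\<lambda>S. of_bool (S \<in> G)) = (\<lambda>S. of_bool (S \<in> compress_set j G))"
  by (auto simp: compress_def compress_set_def fun_eq_iff)

text \<open>Flipping \<open>j\<close> permutes \<open>Pow U\<close>, so summing the hypothesis gives
  twice the claim.\<close>

lemma sum_Pow_flip_le:
  fixes g h :: "'a set \<Rightarrow> real"
  assumes "j \<in> U" and le: "\<And>S. S \<in> Pow U \<Longrightarrow> g S + g (flip j S) \<le> h S + h (flip j S)"
  shows "sum g (Pow U) \<le> sum h (Pow U)"
proof -
  have flip: "(\<Sum>S\<in>Pow U. k (flip j S)) = sum k (Pow U)" for k :: "'a set \<Rightarrow> real"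
    by (rule sum.reindex_bij_witness[of _ "flip j" "flip j"]) (use assms(1) in \<open>auto simp only: flip_flip flip_in_Pow\<close>)
  have "(\<Sum>S\<in>Pow U. g S + g (flip j S)) \<le> (\<Sum>S\<in>Pow U. h S + h (flip j S))"
    by (rule sum_mono) (rule le)
  then show ?thesis by (simp add: sum.distrib flip)
qed

lemma sum_Pow_flip_eq:
  fixes g h :: "'a set \<Rightarrow> real"
  assumes "j \<in> U" "\<And>S. S \<in> Pow U \<Longrightarrow> g S + g (flip j S) = h S + h (flip j S)"
  shows "sum g (Pow U) = sum h (Pow U)"
  by (intro antisym sum_Pow_flip_le[OF assms(1)]) (simp_all add: assms(2))

lemma mem_flip_self: "j \<in> flip j S \<longleftrightarrow> j \<notin> S"
  by (simp add: mem_flip_iff)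

text \<open>Compression only rearranges the two values on each pair \<open>S\<close>,
  \<open>flip j S\<close>. Squaring as \<open>h\<close> gives the norm, the identity on an indicator
  the size of a family.\<close>

lemma sum_compress:
  fixes h :: "real \<Rightarrow> real"
  assumes "j \<in> U"
  shows "(\<Sum>S\<in>Pow U. h (compress j f S)) = (\<Sum>S\<in>Pow U. h (f S))"
  by (rule sum_Pow_flip_eq[OF assms]) (auto simp: compress_def mem_flip_self min_def max_def)

lemma rearrangement_max_min:
  fixes a b c d :: real
  shows "a * c + b * d \<le> max a b * max c d + min a b * min c d"
proof -
  have "0 \<le> (a - b) * (d - c)" if "(a \<le> b \<and> d \<le> c) \<or> (b \<le> a \<and> c \<le> d)"
    using that by (auto intro: mult_nonneg_nonneg mult_nonpos_nonpos)
  then show ?thesis by (auto simp: max_def min_def algebra_simps)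
qed

text \<open>In direction \<open>j\<close> the product of the two values is unchanged. In another
  direction \<open>i\<close>, compression sorts both \<open>j\<close>-pairs of a square in the same
  order, and the rearrangement inequality applies.\<close>

lemma cube_form_compress:
  assumes "j \<in> U"
  shows "cube_form U f \<le> cube_form U (compress j f)"
proof -
  let ?g = "compress j f"
  have "(\<Sum>S\<in>Pow U. f S * f (flip i S)) \<le> (\<Sum>S\<in>Pow U. ?g S * ?g (flip i S))" for i
  proof (rule sum_Pow_flip_le[OF assms])
    fix S
    show "f S * f (flip i S) + f (flip j S) * f (flip i (flip j S))
        \<le> ?g S * ?g (flip i S) + ?g (flip j S) * ?g (flip i (flip j S))"
    proof (cases "i = j")
      case True
      then show ?thesis by (auto simp: compress_def mem_flip_self min_def max_def)
    next
      case False
      then have "j \<in> flip i T \<longleftrightarrow> j \<in> T" for T by (auto simp: mem_flip_iff)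
      then show ?thesis
        using rearrangement_max_min[of "f S" "f (flip i S)" "f (flip j S)" "f (flip i (flip j S))"]
        by (auto simp: compress_def mem_flip_self flip_commute[of j i] max.commute min.commute)
    qed
  qed
  then show ?thesis
    unfolding cube_form_def by (subst (1 2) sum.swap) (rule sum_mono)
qed

lemma compress_set_subset: "j \<in> U \<Longrightarrow> G \<subseteq> Pow U \<Longrightarrow> compress_set j G \<subseteq> Pow U"
  using flip_in_Pow[of j U] by (auto simp: compress_set_def split: if_splits simp del: Pow_iff)

lemma card_eq_sum_Pow:
  assumes "finite U" "G \<subseteq> Pow U"
  shows "real (card G) = (\<Sum>S\<in>Pow U. of_bool (S \<in> G))"
  using assms by (simp add: Int_absorb1)

lemma flip_Diff: "i \<noteq> j \<Longrightarrow> flip j (S - {i}) = flip j S - {i}"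
  by (auto simp: set_eq_iff mem_flip_iff)

text \<open>Vector and family are compressed together, one direction of \<open>J\<close> after
  another. A new compression preserves closure in the earlier directions, so one pass
  suffices.\<close>

lemma exists_compression:
  assumes U: "finite U" and J: "J \<subseteq> U"
    and G: "G \<subseteq> Pow U" and nonneg: "\<And>S. f S \<ge> 0" and supp: "\<And>S. f S \<noteq> 0 \<Longrightarrow> S \<in> G"
  obtains g D where "D \<subseteq> Pow U" "card D = card G"
    "cube_form U (\<lambda>S. of_bool (S \<in> G)) \<le> cube_form U (\<lambda>S. of_bool (S \<in> D))"
    "(\<Sum>S\<in>Pow U. g S ^ 2) = (\<Sum>S\<in>Pow U. f S ^ 2)" "cube_form U f \<le> cube_form U g"
    "\<And>S. g S \<ge> 0" "\<And>S. g S \<noteq> 0 \<Longrightarrow> S \<in> D" "\<And>i S. i \<in> J \<Longrightarrow> S \<in> D \<Longrightarrow> S - {i} \<in> D"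
proof -
  have "finite J" using J U by (rule finite_subset)
  then have "\<exists>g D. D \<subseteq> Pow U \<and> card D = card G \<and>
    cube_form U (\<lambda>S. of_bool (S \<in> G)) \<le> cube_form U (\<lambda>S. of_bool (S \<in> D)) \<and>
    (\<Sum>S\<in>Pow U. g S ^ 2) = (\<Sum>S\<in>Pow U. f S ^ 2) \<and> cube_form U f \<le> cube_form U g \<and>
    (\<forall>S. g S \<ge> 0) \<and> (\<forall>S. g S \<noteq> 0 \<longrightarrow> S \<in> D) \<and> (\<forall>i\<in>J. \<forall>S\<in>D. S - {i} \<in> D)"
    using J
  proof (induction J)
    case empty
    show ?case using G nonneg supp by (intro exI[of _ f] exI[of _ G]) auto
  next
    case (insert j J)
    then obtain g D where IH: "D \<subseteq> Pow U" "card D = card G"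
      "cube_form U (\<lambda>S. of_bool (S \<in> G)) \<le> cube_form U (\<lambda>S. of_bool (S \<in> D))"
      "(\<Sum>S\<in>Pow U. g S ^ 2) = (\<Sum>S\<in>Pow U. f S ^ 2)" "cube_form U f \<le> cube_form U g"
      "\<forall>S. g S \<ge> 0" "\<forall>S. g S \<noteq> 0 \<longrightarrow> S \<in> D" "\<forall>i\<in>J. \<forall>S\<in>D. S - {i} \<in> D"
      by auto
    have j: "j \<in> U" using insert.prems by simp
    let ?g = "compress j g" and ?D = "compress_set j D"
    have sub: "?D \<subseteq> Pow U" by (rule compress_set_subset[OF j IH(1)])
    have "real (card ?D) = real (card D)"
      unfolding card_eq_sum_Pow[OF U sub] card_eq_sum_Pow[OF U IH(1)]
      using sum_compress[OF j, of "\<lambda>x. x" "\<lambda>S. of_bool (S \<in> D)"] by (simp only: compress_indicator)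
    moreover have "cube_form U (\<lambda>S. of_bool (S \<in> D)) \<le> cube_form U (\<lambda>S. of_bool (S \<in> ?D))"
      using cube_form_compress[OF j, of "\<lambda>S. of_bool (S \<in> D)"] by (simp only: compress_indicator)
    moreover have "(\<Sum>S\<in>Pow U. ?g S ^ 2) = (\<Sum>S\<in>Pow U. g S ^ 2)"
      by (rule sum_compress[OF j])
    moreover have "cube_form U g \<le> cube_form U ?g" by (rule cube_form_compress[OF j])
    moreover have "\<forall>S. ?g S \<ge> 0" using IH(6) by (simp add: compress_def le_max_iff_disj)
    moreover have "S \<in> ?D" if "?g S \<noteq> 0" for S
    proof -
      have 0: "g T = 0" if "T \<notin> D" for T using IH(7) that by blast
      \<comment> \<open>For nonnegative values a nonzero minimum forces both values to be nonzero,
        which matches the membership rule for sets containing \<open>j\<close>.\<close>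
      have "\<not> g S < 0" "\<not> g (flip j S) < 0" using IH(6) by (simp_all add: not_less)
      then show ?thesis
        using that 0[of S] 0[of "flip j S"]
        by (auto simp: compress_set_def compress_def min_def max_def split: if_splits)
    qed
    moreover have "S - {i} \<in> ?D" if "i \<in> insert j J" "S \<in> ?D" for i S
    proof (cases "i = j")
      case True
      show ?thesis
      proof (cases "j \<in> S")
        case True
        then have "flip j S \<in> D" using that(2) by (simp add: compress_set_def)
        moreover have "S - {j} = flip j S" using True by (simp add: flip_def)
        ultimately have "S - {j} \<in> D" by simp
        then show ?thesis using \<open>i = j\<close> by (simp add: compress_set_def)
      qed (use that(2) \<open>i = j\<close> in simp)
    next
      case False
      \<comment> \<open>Removing \<open>i\<close> commutes with flipping \<open>j\<close>, so both
        sets of a pair lose \<open>i\<close> together.\<close>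
      then show ?thesis using that IH(8) by (auto simp: compress_set_def flip_Diff split: if_splits)
    qed
    ultimately show ?case
      using IH sub by (intro exI[of _ ?g] exI[of _ ?D]) auto
  qed
  then show thesis using that by blast
qed

lemma finite_downsetI:
  assumes U: "finite U" "D \<subseteq> Pow U" "D \<noteq> {}" and cl: "\<And>i S. i \<in> U \<Longrightarrow> S \<in> D \<Longrightarrow> S - {i} \<in> D"
  shows "finite_downset D"
proof
  have closed: "S - R \<in> D" if "S \<in> D" "finite R" "R \<subseteq> U" for S R
    using that(2,3,1)
  proof (induction R)
    case (insert x R)
    have "S - insert x R = (S - R) - {x}" by auto
    then show ?case using insert cl by simp
  qed simp
  show down: "T \<in> D" if "S \<in> D" "T \<subseteq> S" for S T
  proof -
    have "S - T \<subseteq> U" using U(2) that(1) by auto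
    then have "S - (S - T) \<in> D" using that(1) U(1) by (intro closed) (auto intro: finite_subset)
    moreover have "S - (S - T) = T" using that(2) by auto
    ultimately show ?thesis by simp
  qed
  show "finite D" using U(1,2) by (auto intro: finite_subset)
  show "finite S" if "S \<in> D" for S using that U(1,2) by (auto intro: finite_subset)
  show "{} \<in> D" using U(3) down by blast
qed

lemma cube_form_eq_sum_adj:
  assumes U: "finite U" and G: "G \<subseteq> Pow U" and supp: "\<And>S. f S \<noteq> 0 \<Longrightarrow> S \<in> G"
  shows "cube_form U f = (\<Sum>S\<in>G. \<Sum>T\<in>G. of_bool (adj S T) * (f S * f T))"
proof -
  have 0: "f S = 0" if "S \<notin> G" for S using supp that by blast
  have "(\<Sum>i\<in>U. f S * f (flip i S)) = (\<Sum>T\<in>G. of_bool (adj S T) * (f S * f T))" if S: "S \<in> Pow U" for S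
  proof -
    have "(\<Sum>i\<in>U. f S * f (flip i S)) = (\<Sum>T\<in>(\<lambda>i. flip i S) ` U. f S * f T)"
      by (subst sum.reindex[OF inj_flip]) simp
    also have "(\<lambda>i. flip i S) ` U = {T \<in> Pow U. adj S T}"
    proof (intro equalityI subsetI)
      fix T assume "T \<in> {T \<in> Pow U. adj S T}"
      then obtain i where i: "T = flip i S" "T \<in> Pow U" by (auto simp: adj_def)
      then have "i \<in> U" using S mem_flip_self[of i S] by (cases "i \<in> S") auto
      then show "T \<in> (\<lambda>i. flip i S) ` U" using i by simp
    qed (use S flip_in_Pow[of _ U S] in auto)
    also have "(\<Sum>T\<in>\<dots>. f S * f T) = (\<Sum>T\<in>Pow U. of_bool (adj S T) * (f S * f T))"
      unfolding sum.inter_filter[OF finite_Pow_iff[THEN iffD2, OF U]] by (rule sum.cong) auto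
    also have "\<dots> = (\<Sum>T\<in>G. of_bool (adj S T) * (f S * f T))"
      by (rule sum.mono_neutral_right) (use U G 0 in auto)
    finally show ?thesis .
  qed
  then have "cube_form U f = (\<Sum>S\<in>Pow U. \<Sum>T\<in>G. of_bool (adj S T) * (f S * f T))"
    by (simp add: cube_form_def)
  also have "\<dots> = (\<Sum>S\<in>G. \<Sum>T\<in>G. of_bool (adj S T) * (f S * f T))"
    by (rule sum.mono_neutral_right) (use U G 0 in auto)
  finally show ?thesis .
qed

text \<open>Without big sets only the edges from \<open>{}\<close> to the atoms remain. Hence a
  family with too many edges for a star cannot compress to a down-set without big sets.\<close>

lemma (in finite_downset) sum_adj_le_if_no_big:
  assumes "big = {}"
  shows "(\<Sum>S\<in>D. \<Sum>T\<in>D. of_bool (adj S T) * 1) \<le> 2 * (real (card D) - 1)"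
proof -
  have "(\<Sum>S\<in>D. \<Sum>T\<in>D. of_bool (adj S T) * 1) = (\<Sum>S\<in>D. real (card S)) + (\<Sum>S\<in>D. real (card (up S)) * 1)"
    unfolding sum_adj by (simp add: card_nb sum.distrib)
  also have "(\<Sum>S\<in>D. real (card (up S)) * 1) = (\<Sum>S\<in>D. real (card S) * 1)"
    by (rule sum_up)
  finally have 1: "(\<Sum>S\<in>D. \<Sum>T\<in>D. of_bool (adj S T) * 1) = 2 * (\<Sum>S\<in>D. real (card S))" by simp
  have "(\<Sum>S\<in>D. real (card S)) = (\<Sum>S\<in>D - {{}}. real (card S))"
    by (rule sum.mono_neutral_right) (use fin in auto)
  also have "\<dots> \<le> (\<Sum>S\<in>D - {{}}. 1)"
    using assms by (intro sum_mono) (auto simp: big_def not_le less_Suc_eq_le numeral_2_eq_2)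
  also have "\<dots> = real (card D) - 1"
    using card_Suc_Diff1[OF fin ne] by simp
  finally show ?thesis unfolding 1 by simp
qed

section \<open>Spectral bounds\<close>

text \<open>Cauchy-Schwarz twice: over \<open>X\<close> to separate \<open>f\<close>, then over
  pairs from \<open>Y\<close> to separate the products of values of \<open>g\<close>. The last
  factor is the trace of the squared Gram matrix of the columns of \<open>a\<close>.\<close>

lemma bilinear_fourth_power_le:
  fixes a :: "'a \<Rightarrow> 'b \<Rightarrow> real"
  shows "(\<Sum>x\<in>X. \<Sum>y\<in>Y. a x y * (f x * g y)) ^ 4 \<le>
    (\<Sum>x\<in>X. f x ^ 2) ^ 2 * (\<Sum>y\<in>Y. g y ^ 2) ^ 2 * (\<Sum>y\<in>Y. \<Sum>z\<in>Y. (\<Sum>x\<in>X. a x y * a x z) ^ 2)"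
proof -
  let ?F = "\<Sum>x\<in>X. f x ^ 2" and ?G = "\<Sum>y\<in>Y. g y ^ 2" and ?B = "\<Sum>x\<in>X. \<Sum>y\<in>Y. a x y * (f x * g y)"
  let ?c = "\<lambda>y z. \<Sum>x\<in>X. a x y * a x z"
  define k where "k = (\<Sum>x\<in>X. (\<Sum>y\<in>Y. a x y * g y) ^ 2)"
  have "?B = (\<Sum>x\<in>X. f x * (\<Sum>y\<in>Y. a x y * g y))"
    by (simp add: sum_distrib_left mult_ac)
  then have 1: "?B ^ 2 \<le> ?F * k"
    unfolding k_def by (simp only: Cauchy_Schwarz_ineq_sum)
  have "k = (\<Sum>x\<in>X. \<Sum>y\<in>Y. \<Sum>z\<in>Y. (a x y * g y) * (a x z * g z))"
    by (simp add: k_def power2_eq_square sum_product)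
  also have "\<dots> = (\<Sum>y\<in>Y. \<Sum>x\<in>X. \<Sum>z\<in>Y. (a x y * g y) * (a x z * g z))"
    by (rule sum.swap)
  also have "\<dots> = (\<Sum>y\<in>Y. \<Sum>z\<in>Y. \<Sum>x\<in>X. (a x y * g y) * (a x z * g z))"
    by (rule sum.cong[OF refl]) (rule sum.swap)
  also have "\<dots> = (\<Sum>y\<in>Y. \<Sum>z\<in>Y. (g y * g z) * ?c y z)"
    by (simp add: sum_distrib_left mult_ac)
  also have "\<dots> = (\<Sum>(y,z)\<in>Y \<times> Y. (g y * g z) * ?c y z)"
    by (rule sum.cartesian_product)
  also have "\<dots> = (\<Sum>p\<in>Y \<times> Y. (g (fst p) * g (snd p)) * ?c (fst p) (snd p))"
    by (simp add: case_prod_beta)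
  finally have "k ^ 2 \<le> (\<Sum>p\<in>Y \<times> Y. (g (fst p) * g (snd p)) ^ 2) * (\<Sum>p\<in>Y \<times> Y. ?c (fst p) (snd p) ^ 2)"
    by (simp only: Cauchy_Schwarz_ineq_sum)
  also have "(\<Sum>p\<in>Y \<times> Y. (g (fst p) * g (snd p)) ^ 2) = (\<Sum>y\<in>Y. \<Sum>z\<in>Y. g y ^ 2 * g z ^ 2)"
    by (simp add: sum.cartesian_product case_prod_beta power_mult_distrib)
  also have "\<dots> = ?G ^ 2" by (simp add: sum_product power2_eq_square)
  also have "(\<Sum>p\<in>Y \<times> Y. ?c (fst p) (snd p) ^ 2) = (\<Sum>y\<in>Y. \<Sum>z\<in>Y. ?c y z ^ 2)"
    by (simp add: sum.cartesian_product case_prod_beta)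
  finally have 2: "k ^ 2 \<le> ?G ^ 2 * (\<Sum>y\<in>Y. \<Sum>z\<in>Y. ?c y z ^ 2)" .
  have "?B ^ 4 = (?B ^ 2) ^ 2" by simp
  also have "\<dots> \<le> (?F * k) ^ 2" using 1 by (rule power_mono) simp
  also have "\<dots> = ?F ^ 2 * k ^ 2" by (rule power_mult_distrib)
  also have "\<dots> \<le> ?F ^ 2 * (?G ^ 2 * (\<Sum>y\<in>Y. \<Sum>z\<in>Y. ?c y z ^ 2))"
    using 2 by (rule mult_left_mono) simp
  finally show ?thesis by (simp only: mult.assoc)
qed

definition evens :: "'a set set \<Rightarrow> 'a set set" where
  "evens G = {S \<in> G. even (card S)}"

definition odds :: "'a set set \<Rightarrow> 'a set set" where
  "odds G = {S \<in> G. odd (card S)}"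

lemma finite_evens [simp]: "finite G \<Longrightarrow> finite (evens G)"
  and finite_odds [simp]: "finite G \<Longrightarrow> finite (odds G)"
  by (simp_all add: evens_def odds_def)

lemma evens_Un_odds: "evens G \<union> odds G = G" and evens_Int_odds: "evens G \<inter> odds G = {}"
  by (auto simp: evens_def odds_def)

lemma sum_evens_odds: "finite G \<Longrightarrow> sum h (evens G) + sum h (odds G) = sum h G" for h :: "'a set \<Rightarrow> real"
  using sum.union_disjoint[of "evens G" "odds G" h] by (simp add: evens_Un_odds evens_Int_odds)

lemma sum_adj_bipartite:
  fixes f :: "'a set \<Rightarrow> real"
  assumes G: "finite G" "\<And>S. S \<in> G \<Longrightarrow> finite S"
  shows "(\<Sum>S\<in>G. \<Sum>T\<in>G. of_bool (adj S T) * (f S * f T)) =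
    2 * (\<Sum>S\<in>evens G. \<Sum>T\<in>odds G. of_bool (adj S T) * (f S * f T))"
proof -
  let ?h = "\<lambda>S T. of_bool (adj S T) * (f S * f T)"
  have par: "even (card T) \<longleftrightarrow> odd (card S)" if "S \<in> G" "adj S T" for S T
    using adj_parity[OF that(2)] G(2)[OF that(1)] .
  have "(\<Sum>S\<in>G. \<Sum>T\<in>G. ?h S T) = (\<Sum>S\<in>evens G. \<Sum>T\<in>G. ?h S T) + (\<Sum>S\<in>odds G. \<Sum>T\<in>G. ?h S T)"
    using sum_evens_odds[OF G(1)] by simp
  also have "(\<Sum>S\<in>evens G. \<Sum>T\<in>G. ?h S T) = (\<Sum>S\<in>evens G. \<Sum>T\<in>odds G. ?h S T)"
    by (intro sum.cong[OF refl] sum.mono_neutral_right G(1)) (auto simp: evens_def odds_def dest: par)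
  also have "(\<Sum>S\<in>odds G. \<Sum>T\<in>G. ?h S T) = (\<Sum>S\<in>odds G. \<Sum>T\<in>evens G. ?h S T)"
    by (intro sum.cong[OF refl] sum.mono_neutral_right G(1)) (auto simp: evens_def odds_def dest: par)
  also have "\<dots> = (\<Sum>T\<in>evens G. \<Sum>S\<in>odds G. ?h S T)" by (rule sum.swap)
  also have "\<dots> = (\<Sum>S\<in>evens G. \<Sum>T\<in>odds G. ?h S T)"
    by (intro sum.cong refl) (simp add: adj_sym mult.commute)
  finally show ?thesis by simp
qed

text \<open>The bilinear estimate is applied from both sides of the bipartition and averaged,
  because \<open>2 * energy\<close> bounds the sum of the two codegree sums. The factor 16 from
  doubling \<open>?b\<close> is absorbed by squaring \<open>4 * A * B <= (A + B)^2\<close>.\<close>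

lemma (in finite_downset) adj_form_fourth_power_le:
  fixes f :: "'a set \<Rightarrow> real"
  shows "(\<Sum>S\<in>D. \<Sum>T\<in>D. of_bool (adj S T) * (f S * f T)) ^ 4 \<le> (\<Sum>S\<in>D. f S ^ 2) ^ 4 * energy"
proof -
  let ?a = "\<lambda>S T. of_bool (adj S T) :: real"
  let ?X = "evens D" and ?Y = "odds D"
  let ?A = "\<Sum>S\<in>?X. f S ^ 2" and ?B = "\<Sum>S\<in>?Y. f S ^ 2"
  let ?b = "\<Sum>S\<in>?X. \<Sum>T\<in>?Y. ?a S T * (f S * f T)"
  let ?Q = "\<lambda>Z. \<Sum>S\<in>Z. \<Sum>T\<in>Z. codeg S T ^ 2"
  have sq: "(\<Sum>S\<in>Z. ?a S T * ?a S V) ^ 2 \<le> codeg T V ^ 2" if "Z \<subseteq> D" for Z T V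
    unfolding codeg_def using that fin by (intro power_mono sum_mono2 sum_nonneg) auto
  have "?b ^ 4 \<le> ?A ^ 2 * ?B ^ 2 * (\<Sum>T\<in>?Y. \<Sum>V\<in>?Y. (\<Sum>S\<in>?X. ?a S T * ?a S V) ^ 2)"
    by (rule bilinear_fourth_power_le)
  also have "\<dots> \<le> ?A ^ 2 * ?B ^ 2 * ?Q ?Y"
    by (intro mult_left_mono sum_mono sq) (auto simp: evens_def)
  finally have 1: "?b ^ 4 \<le> ?A ^ 2 * ?B ^ 2 * ?Q ?Y" .
  have "?b = (\<Sum>T\<in>?Y. \<Sum>S\<in>?X. ?a T S * (f T * f S))"
    by (subst sum.swap) (simp add: adj_sym mult.commute)
  then have "?b ^ 4 \<le> ?B ^ 2 * ?A ^ 2 * (\<Sum>T\<in>?X. \<Sum>V\<in>?X. (\<Sum>S\<in>?Y. ?a S T * ?a S V) ^ 2)"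
    by (simp only: bilinear_fourth_power_le)
  also have "\<dots> \<le> ?B ^ 2 * ?A ^ 2 * ?Q ?X"
    by (intro mult_left_mono sum_mono sq) (auto simp: odds_def)
  finally have 2: "?b ^ 4 \<le> ?A ^ 2 * ?B ^ 2 * ?Q ?X" by (simp only: mult.commute)
  have "?Q ?X + ?Q ?Y \<le> (\<Sum>S\<in>?X. \<Sum>T\<in>D. codeg S T ^ 2) + (\<Sum>S\<in>?Y. \<Sum>T\<in>D. codeg S T ^ 2)"
    using fin by (intro add_mono sum_mono sum_mono2) (auto simp: evens_def odds_def)
  also have "\<dots> = ?Q D" by (rule sum_evens_odds[OF fin])
  also have "\<dots> \<le> 2 * energy" by (rule sum_codeg_square_le)
  finally have Q: "?Q ?X + ?Q ?Y \<le> 2 * energy" .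
  have "2 * ?b ^ 4 \<le> ?A ^ 2 * ?B ^ 2 * (?Q ?X + ?Q ?Y)" using 1 2 by (simp add: distrib_left)
  also have "\<dots> \<le> ?A ^ 2 * ?B ^ 2 * (2 * energy)" using Q by (intro mult_left_mono) auto
  finally have b: "?b ^ 4 \<le> ?A ^ 2 * ?B ^ 2 * energy" by simp
  have "0 \<le> ?Q D" by (intro sum_nonneg) simp
  then have e0: "0 \<le> energy" using sum_codeg_square_le by linarith
  have "4 * (?A * ?B) \<le> (?A + ?B) ^ 2" using sum_squares_bound[of ?A ?B] by (simp add: power2_sum)
  then have "(4 * (?A * ?B)) ^ 2 \<le> ((?A + ?B) ^ 2) ^ 2" by (rule power_mono) (simp add: sum_nonneg)
  then have AB: "16 * (?A ^ 2 * ?B ^ 2) \<le> (?A + ?B) ^ 4" by (simp add: power_mult_distrib)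
  have "(2 * ?b) ^ 4 = 16 * ?b ^ 4" by (simp add: power_mult_distrib)
  also have "\<dots> \<le> 16 * (?A ^ 2 * ?B ^ 2) * energy" using b by simp
  also have "\<dots> \<le> (?A + ?B) ^ 4 * energy" using AB e0 by (rule mult_right_mono)
  also have "?A + ?B = (\<Sum>S\<in>D. f S ^ 2)" by (rule sum_evens_odds[OF fin])
  finally show ?thesis using sum_adj_bipartite[OF fin fin_elem] by simp
qed

text \<open>Two distinct members of \<open>P\<close> are flips of one fixed \<open>V\<close> in
  \<open>R\<close>, and \<open>common_neighbour\<close> leaves only two candidates for members of
  \<open>R\<close>.\<close>

lemma card_common_neighbours_le:
  assumes P: "\<And>S T. S \<in> P \<Longrightarrow> T \<in> R \<Longrightarrow> adj S T" and fin: "finite P" "finite R"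
    and two: "card P \<ge> 2"
  shows "card R \<le> 2"
proof -
  obtain S S' where S: "S \<in> P" "S' \<in> P" "S \<noteq> S'"
    using two fin(1) by (metis card_le_Suc0_iff_eq not_less_eq_eq numeral_2_eq_2)
  show ?thesis
  proof (cases "R = {}")
    case False
    then obtain V where V: "V \<in> R" by blast
    obtain i j where ij: "S = flip i V" "S' = flip j V"
      using P[OF S(1) V] P[OF S(2) V] by (metis adj_def adj_sym)
    have "W = V \<or> W = flip i (flip j V)" if "W \<in> R" for W
    proof (rule common_neighbour)
      show "adj W (flip i V)" using P[OF S(1) that] ij(1) adj_sym by blast
      show "adj W (flip j V)" using P[OF S(2) that] ij(2) adj_sym by blast
    qed (use ij S(3) in blast)
    then have "R \<subseteq> {V, flip i (flip j V)}" by blast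
    then have "card R \<le> card {V, flip i (flip j V)}" by (intro card_mono) auto
    also have "\<dots> \<le> 2" by (simp add: card_insert_if)
    finally show ?thesis .
  qed simp
qed

text \<open>Cauchy-Schwarz over the edges, then enlargement to all pairs of the support, then
  \<open>4 * A * B <= (A + B)^2\<close>. At equality the edges are exactly \<open>P\<close> times
  \<open>R\<close>, and \<open>card P * card R = card G - 1 >= 5\<close> rules out two parts of size
  at least two.\<close>

lemma few_edges_bound:
  fixes f :: "'a set \<Rightarrow> real"
  assumes G: "finite G" "\<And>S. S \<in> G \<Longrightarrow> finite S"
    and edges: "(\<Sum>S\<in>G. \<Sum>T\<in>G. of_bool (adj S T) * 1) \<le> 2 * (real (card G) - 1)"
  defines "N \<equiv> \<Sum>S\<in>G. f S ^ 2" and "q \<equiv> \<Sum>S\<in>G. \<Sum>T\<in>G. of_bool (adj S T) * (f S * f T)"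
  shows "q ^ 2 \<le> (real (card G) - 1) * N ^ 2"
    and "card G \<ge> 6 \<Longrightarrow> N > 0 \<Longrightarrow> q ^ 2 = (real (card G) - 1) * N ^ 2 \<Longrightarrow>
      \<exists>P R. G = P \<union> R \<and> P \<inter> R = {} \<and> card P = 1 \<and> card R = card G - 1 \<and>
        (\<forall>S\<in>G. \<forall>T\<in>G. adj S T \<longleftrightarrow> (S, T) \<in> P \<times> R \<union> R \<times> P)"
proof -
  let ?X = "evens G" and ?Y = "odds G" and ?n = "real (card G) - 1"
  let ?A = "\<Sum>S\<in>?X. f S ^ 2" and ?B = "\<Sum>S\<in>?Y. f S ^ 2"
  define E0 where "E0 = {(S, T) \<in> ?X \<times> ?Y. adj S T}"
  \<comment> \<open>On the support of \<open>f\<close> every pair has positive weight, so a pair of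
    \<open>P\<close> times \<open>R\<close> missing from \<open>E\<close> would make the estimate
    strict.\<close>
  define E where "E = {(S, T) \<in> E0. f S \<noteq> 0 \<and> f T \<noteq> 0}"
  define P where "P = {S \<in> ?X. f S \<noteq> 0}"
  define R where "R = {S \<in> ?Y. f S \<noteq> 0}"
  let ?w = "\<lambda>p. f (fst p) * f (snd p)"
  have fE0: "finite E0" unfolding E0_def by (rule finite_subset[of _ "?X \<times> ?Y"]) (use G in auto)
  have EE0: "E \<subseteq> E0" and EPR: "E \<subseteq> P \<times> R" by (auto simp: E_def P_def R_def E0_def)
  have fE: "finite E" using EE0 fE0 by (rule finite_subset)
  have fPR: "finite P" "finite R" using G by (auto simp: P_def R_def)
  have sumE0: "(\<Sum>S\<in>?X. \<Sum>T\<in>?Y. of_bool (adj S T) * (h S * h T)) = (\<Sum>p\<in>E0. h (fst p) * h (snd p))"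
    for h :: "'a set \<Rightarrow> real"
  proof -
    have "(\<Sum>S\<in>?X. \<Sum>T\<in>?Y. of_bool (adj S T) * (h S * h T)) =
        (\<Sum>p\<in>?X \<times> ?Y. of_bool (p \<in> E0) * (h (fst p) * h (snd p)))"
      unfolding sum.cartesian_product by (rule sum.cong) (auto simp: E0_def)
    also have "\<dots> = (\<Sum>p\<in>E0. of_bool (p \<in> E0) * (h (fst p) * h (snd p)))"
      by (rule sum.mono_neutral_right) (use G in \<open>auto simp: E0_def\<close>)
    finally show ?thesis by simp
  qed
  have card_E0: "real (card E0) \<le> ?n"
    using edges sum_adj_bipartite[OF G, of "\<lambda>_. 1"] sumE0[of "\<lambda>_. 1"] by simp
  have card_E: "card E \<le> card E0" by (rule card_mono[OF fE0 EE0])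
  have AB: "N = ?A + ?B" unfolding N_def by (rule sum_evens_odds[OF G(1), symmetric])
  have "q = 2 * (\<Sum>p\<in>E0. ?w p)"
    unfolding q_def using sum_adj_bipartite[OF G, of f] sumE0[of f] by simp
  also have "(\<Sum>p\<in>E0. ?w p) = (\<Sum>p\<in>E. ?w p)"
    by (rule sum.mono_neutral_right[OF fE0 EE0]) (auto simp: E_def)
  finally have q: "q = 2 * (\<Sum>p\<in>E. 1 * ?w p)" by simp
  have cs: "q ^ 2 \<le> 4 * (real (card E) * (\<Sum>p\<in>E. ?w p ^ 2))"
  proof -
    have "(\<Sum>p\<in>E. 1 * ?w p) ^ 2 \<le> (\<Sum>p\<in>E. 1 ^ 2) * (\<Sum>p\<in>E. ?w p ^ 2)"
      by (rule Cauchy_Schwarz_ineq_sum)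
    moreover have "(\<Sum>p\<in>E. 1 ^ 2) = real (card E)" by simp
    ultimately show ?thesis unfolding q power_mult_distrib[of 2] by simp
  qed
  have PR: "(\<Sum>p\<in>P \<times> R. ?w p ^ 2) = ?A * ?B"
  proof -
    have "(\<Sum>S\<in>P. f S ^ 2) = ?A" "(\<Sum>S\<in>R. f S ^ 2) = ?B"
      by (rule sum.mono_neutral_left; use G in \<open>auto simp: P_def R_def\<close>)+
    then have "?A * ?B = (\<Sum>S\<in>P. \<Sum>T\<in>R. f S ^ 2 * f T ^ 2)" by (simp only: flip: sum_product)
    also have "\<dots> = (\<Sum>p\<in>P \<times> R. ?w p ^ 2)"
      unfolding sum.cartesian_product by (rule sum.cong) (auto simp: power_mult_distrib)
    finally show ?thesis by simp
  qed
  have wE: "(\<Sum>p\<in>E. ?w p ^ 2) \<le> ?A * ?B"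
    unfolding PR[symmetric] using fPR EPR by (intro sum_mono2) auto
  have amgm: "4 * (?A * ?B) \<le> N ^ 2"
    unfolding AB using sum_squares_bound[of ?A ?B] by (simp add: power2_sum)
  have w0: "0 \<le> (\<Sum>p\<in>E. ?w p ^ 2)" by (rule sum_nonneg) simp
  have n0: "0 \<le> ?n" using card_E0 by linarith
  have cE: "real (card E) \<le> ?n" using card_E card_E0 by linarith
  have up1: "real (card E) * (\<Sum>p\<in>E. ?w p ^ 2) \<le> ?n * (\<Sum>p\<in>E. ?w p ^ 2)"
    using cE w0 by (rule mult_right_mono)
  have up2: "?n * (\<Sum>p\<in>E. ?w p ^ 2) \<le> ?n * (?A * ?B)" using wE n0 by (rule mult_left_mono)
  have up3: "4 * (?n * (?A * ?B)) \<le> ?n * N ^ 2" using mult_left_mono[OF amgm n0] by (simp add: mult_ac)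
  show "q ^ 2 \<le> ?n * N ^ 2" using cs up1 up2 up3 by linarith
  assume n6: "card G \<ge> 6" and N: "N > 0" and eq: "q ^ 2 = ?n * N ^ 2"
  have n_pos: "?n > 0" using n6 by simp
  then have "?n * N ^ 2 > 0" using N by simp
  have e1: "?n * (\<Sum>p\<in>E. ?w p ^ 2) = ?n * (?A * ?B)"
    and e2: "real (card E) * (\<Sum>p\<in>E. ?w p ^ 2) = ?n * (\<Sum>p\<in>E. ?w p ^ 2)"
    and pos: "?n * (\<Sum>p\<in>E. ?w p ^ 2) > 0"
    using cs up1 up2 up3 eq \<open>?n * N ^ 2 > 0\<close> by linarith+
  have wpos: "(\<Sum>p\<in>E. ?w p ^ 2) > 0" using pos n_pos by (simp add: zero_less_mult_iff)
  then have cardE: "real (card E) = ?n" using e2 by simp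
  have "E = P \<times> R"
  proof (rule ccontr)
    assume "E \<noteq> P \<times> R"
    then obtain p where p: "p \<in> P \<times> R" "p \<notin> E" using EPR by blast
    have "(\<Sum>p\<in>E. ?w p ^ 2) < (\<Sum>p\<in>P \<times> R. ?w p ^ 2)"
      using fPR EPR p by (intro sum_strict_mono2[of _ _ p]) (auto simp: P_def R_def)
    then show False using e1 n_pos unfolding PR by simp
  qed
  moreover have "E = E0"
    using cardE card_E0 EE0 fE0 by (metis card_seteq of_nat_le_iff)
  ultimately have E0: "E0 = P \<times> R" and cPR: "real (card P * card R) = ?n"
    using cardE by (simp_all add: card_cartesian_product)
  have adjPR: "adj S T" if "S \<in> P" "T \<in> R" for S T
  proof -
    have "(S, T) \<in> E0" using that E0 by simp
    then show ?thesis by (simp add: E0_def)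
  qed
  have adj_iff: "adj S T \<longleftrightarrow> (S, T) \<in> P \<times> R \<union> R \<times> P" if ST: "S \<in> G" "T \<in> G" for S T
  proof
    assume a: "adj S T"
    have "(S, T) \<in> E0 \<or> (T, S) \<in> E0"
      using a adj_parity[OF a G(2)[OF ST(1)]] ST by (auto simp: E0_def evens_def odds_def adj_sym)
    then show "(S, T) \<in> P \<times> R \<union> R \<times> P" unfolding E0 by auto
  qed (use adjPR adj_sym in blast)
  have one: "card P = 1 \<or> card R = 1"
  proof (rule ccontr)
    assume *: "\<not> (card P = 1 \<or> card R = 1)"
    have "real (card P * card R) > 0" using cPR n_pos by linarith
    then have "card P * card R > 0" by (simp only: of_nat_0_less_iff)
    then have "card P > 0 \<and> card R > 0" by (simp only: nat_0_less_mult_iff)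
    then have ge: "card P \<ge> 2" "card R \<ge> 2" using * by linarith+
    have "card R \<le> 2" using card_common_neighbours_le[OF adjPR fPR ge(1)] .
    moreover have "adj T S" if "T \<in> R" "S \<in> P" for S T
      using adjPR[OF that(2,1)] adj_sym by blast
    then have "card P \<le> 2" using fPR(2,1) ge(2) by (rule card_common_neighbours_le)
    ultimately have "card P * card R \<le> 2 * 2" by (rule mult_le_mono[rotated])
    then have "real (card P * card R) \<le> real (2 * 2)" by (simp only: of_nat_le_iff)
    then show False using cPR n6 by simp
  qed
  have dis: "P \<inter> R = {}" using evens_Int_odds[of G] by (auto simp: P_def R_def)
  \<comment> \<open>A part of size one turns the product \<open>card G - 1\<close> into the sum
    \<open>card G\<close>, so no vertex lies outside \<open>P\<close> and \<open>R\<close>.\<close>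
  have "real (card P + card R) = real (card G)"
    using one cPR by (elim disjE) simp_all
  then have "card (P \<union> R) = card G" using dis fPR by (simp add: card_Un_disjoint)
  moreover have "P \<union> R \<subseteq> G" by (auto simp: P_def R_def evens_def odds_def)
  ultimately have G_eq: "G = P \<union> R" using G(1) by (metis card_subset_eq)
  have sum: "card P + card R = card G" using \<open>real (card P + card R) = real (card G)\<close> by (simp only: of_nat_eq_iff)
  show "\<exists>P R. G = P \<union> R \<and> P \<inter> R = {} \<and> card P = 1 \<and> card R = card G - 1 \<and>
        (\<forall>S\<in>G. \<forall>T\<in>G. adj S T \<longleftrightarrow> (S, T) \<in> P \<times> R \<union> R \<times> P)"
    using one
  proof
    assume "card P = 1"
    then show ?thesis using G_eq dis sum adj_iff by (intro exI[of _ P] exI[of _ R]) auto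
  next
    assume "card R = 1"
    moreover have "\<forall>S\<in>G. \<forall>T\<in>G. adj S T \<longleftrightarrow> (S, T) \<in> R \<times> P \<union> P \<times> R" using adj_iff by blast
    ultimately show ?thesis using G_eq dis sum by (intro exI[of _ R] exI[of _ P]) auto
  qed
qed

text \<open>The cases are split by the number of edges, which the double sum counts twice. With more
  than \<open>card G - 1\<close> edges the bound is strict for \<open>N > 0\<close>, so equality
  occurs only where \<open>few_edges_bound\<close> yields the star.\<close>

lemma adj_form_le_sqrt:
  assumes U: "finite U" and G: "G \<subseteq> Pow U" and n: "card G \<ge> 103" and nonneg: "\<And>S. h S \<ge> 0"
  defines "N \<equiv> \<Sum>S\<in>G. h S ^ 2" and "q \<equiv> \<Sum>S\<in>G. \<Sum>T\<in>G. of_bool (adj S T) * (h S * h T)"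
  shows "q \<le> sqrt (real (card G) - 1) * N"
    and "N > 0 \<Longrightarrow> q = sqrt (real (card G) - 1) * N \<Longrightarrow>
      \<exists>P R. G = P \<union> R \<and> P \<inter> R = {} \<and> card P = 1 \<and> card R = card G - 1 \<and>
        (\<forall>S\<in>G. \<forall>T\<in>G. adj S T \<longleftrightarrow> (S, T) \<in> P \<times> R \<union> R \<times> P)"
proof -
  let ?n = "real (card G) - 1"
  let ?star = "\<exists>P R. G = P \<union> R \<and> P \<inter> R = {} \<and> card P = 1 \<and> card R = card G - 1 \<and>
        (\<forall>S\<in>G. \<forall>T\<in>G. adj S T \<longleftrightarrow> (S, T) \<in> P \<times> R \<union> R \<times> P)"
  have finG: "finite G" "\<And>S. S \<in> G \<Longrightarrow> finite S"
    using G U by (auto intro: finite_subset)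
  have N0: "N \<ge> 0" unfolding N_def by (rule sum_nonneg) simp
  have n0: "?n > 0" using n by simp
  have "q \<le> sqrt ?n * N \<and> (N > 0 \<longrightarrow> q = sqrt ?n * N \<longrightarrow> ?star)"
  proof (cases "(\<Sum>S\<in>G. \<Sum>T\<in>G. of_bool (adj S T) * 1) \<le> 2 * (real (card G) - 1)")
    case True
    note few = few_edges_bound[OF finG True, of h, folded N_def q_def]
    have "q ^ 2 \<le> (sqrt ?n * N) ^ 2" using few(1) n0 by (simp add: power_mult_distrib)
    then have "q \<le> sqrt ?n * N" by (rule power2_le_imp_le) (use N0 n0 in simp)
    moreover have ?star if "N > 0" "q = sqrt ?n * N"
      by (rule few(2)) (use n n0 that in \<open>simp_all add: power_mult_distrib\<close>)
    ultimately show ?thesis by blast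
  next
    case False
    \<comment> \<open>Compression acts on all of \<open>Pow U\<close>, so the vector is extended by
      0 outside \<open>G\<close>.\<close>
    define f where "f S = (if S \<in> G then h S else 0)" for S
    have f: "\<And>S. f S \<ge> 0" "\<And>S. f S \<noteq> 0 \<Longrightarrow> S \<in> G" using nonneg by (auto simp: f_def split: if_splits)
    obtain g D where D: "D \<subseteq> Pow U" "card D = card G"
      "cube_form U (\<lambda>S. of_bool (S \<in> G)) \<le> cube_form U (\<lambda>S. of_bool (S \<in> D))"
      "(\<Sum>S\<in>Pow U. g S ^ 2) = (\<Sum>S\<in>Pow U. f S ^ 2)" "cube_form U f \<le> cube_form U g"
      "\<And>S. g S \<ge> 0" "\<And>S. g S \<noteq> 0 \<Longrightarrow> S \<in> D" "\<And>i S. i \<in> U \<Longrightarrow> S \<in> D \<Longrightarrow> S - {i} \<in> D"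
    proof (rule exists_compression[OF U order_refl G, of f])
      show "f S \<ge> 0" for S by (rule f(1))
      show "S \<in> G" if "f S \<noteq> 0" for S using that by (rule f(2))
    qed (rule that)
    have "D \<noteq> {}" using D(2) n by auto
    then interpret finite_downset D using D(8) by (intro finite_downsetI[OF U D(1)])
    have sum_supp: "(\<Sum>S\<in>Pow U. k S ^ 2) = (\<Sum>S\<in>K. k S ^ 2)"
      if "K \<subseteq> Pow U" "\<And>S. k S \<noteq> 0 \<Longrightarrow> S \<in> K" for k :: "'a set \<Rightarrow> real" and K
      by (rule sum.mono_neutral_right) (use U that in auto)
    have N: "N = (\<Sum>S\<in>D. g S ^ 2)"
      using sum_supp[OF D(1) D(7)] sum_supp[OF G f(2)] D(4) by (simp add: N_def f_def)
    have "cube_form U f = (\<Sum>S\<in>G. \<Sum>T\<in>G. of_bool (adj S T) * (f S * f T))"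
      by (rule cube_form_eq_sum_adj[OF U G]) (rule f(2))
    also have "\<dots> = q" unfolding q_def by (intro sum.cong refl) (simp add: f_def)
    finally have qf: "q = cube_form U f" by simp
    have q0: "q \<ge> 0" unfolding q_def using nonneg by (intro sum_nonneg) auto
    have "q ^ 4 \<le> (cube_form U g) ^ 4" using D(5) q0 unfolding qf by (intro power_mono) auto
    also have "cube_form U g = (\<Sum>S\<in>D. \<Sum>T\<in>D. of_bool (adj S T) * (g S * g T))"
      by (rule cube_form_eq_sum_adj[OF U D(1)]) (rule D(7))
    also have "\<dots> ^ 4 \<le> N ^ 4 * energy"
      unfolding N by (rule adj_form_fourth_power_le)
    finally have q4: "q ^ 4 \<le> N ^ 4 * energy" .
    \<comment> \<open>\<open>D\<close> has at least as many edges as \<open>G\<close>, too many for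
      a down-set without big sets.\<close>
    have "big \<noteq> {}"
    proof
      assume "big = {}"
      then have "cube_form U (\<lambda>S. of_bool (S \<in> D)) \<le> 2 * (real (card D) - 1)"
        using sum_adj_le_if_no_big cube_form_eq_sum_adj[OF U D(1), of "\<lambda>S. of_bool (S \<in> D)"] by simp
      then show False
        using False D(2,3) cube_form_eq_sum_adj[OF U G, of "\<lambda>S. of_bool (S \<in> G)"] by simp
    qed
    then have en: "energy < ?n ^ 2" using energy_less n D(2) by simp
    show ?thesis
    proof (cases "N > 0")
      case True
      then have "N ^ 4 * energy < N ^ 4 * ?n ^ 2" using en by simp
      also have "\<dots> = (sqrt ?n * N) ^ 4"
      proof -
        have "sqrt ?n ^ 4 = (sqrt ?n ^ 2) ^ 2" by simp
        also have "\<dots> = ?n ^ 2" using n0 by simp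
        finally show ?thesis by (simp add: power_mult_distrib)
      qed
      finally have "q ^ 4 < (sqrt ?n * N) ^ 4" using q4 by linarith
      then have "q < sqrt ?n * N" by (rule power_less_imp_less_base) (use N0 n0 in simp)
      then show ?thesis by simp
    next
      case False
      then have "N = 0" using N0 by simp
      then have "q = 0" using q4 by simp
      then show ?thesis using \<open>N = 0\<close> by simp
    qed
  qed
  then show "q \<le> sqrt ?n * N" and "N > 0 \<Longrightarrow> q = sqrt ?n * N \<Longrightarrow> ?star" by blast+
qed

section \<open>Transfer to induced subgraphs of the hypercube digraph\<close>

lemma hypercube_arcs_iff:
  "(A, B) \<in> arcs (hypercube d) \<longleftrightarrow> A \<in> Pow {1..d} \<and> B \<in> Pow {1..d} \<and> adj A B"
proof -
  have "(\<exists>!i. i \<in> {1..d} \<and> (i \<in> A) \<noteq> (i \<in> B)) \<longleftrightarrow> adj A B"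
    if AB: "A \<subseteq> {1..d}" "B \<subseteq> {1..d}"
  proof
    assume "\<exists>!i. i \<in> {1..d} \<and> (i \<in> A) \<noteq> (i \<in> B)"
    then obtain i where i: "(i \<in> A) \<noteq> (i \<in> B)" "\<And>j. j \<in> {1..d} \<and> (j \<in> A) \<noteq> (j \<in> B) \<Longrightarrow> j = i"
      by blast
    have "x \<in> B \<longleftrightarrow> x \<in> flip i A" for x
      using i AB by (cases "x = i") (auto simp only: mem_flip_iff)
    then show "adj A B" unfolding adj_def by blast
  next
    assume "adj A B"
    then obtain i where i: "B = flip i A" by (auto simp: adj_def)
    have "i \<in> {1..d}" using AB mem_flip_iff[of i i A] i by blast
    then show "\<exists>!i. i \<in> {1..d} \<and> (i \<in> A) \<noteq> (i \<in> B)"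
      unfolding i mem_flip_iff by blast
  qed
  then show ?thesis unfolding hypercube_def by auto
qed

lemma induced_subgraph_hypercube:
  assumes "induced_subgraph G (hypercube d)"
  shows "graph G" and "verts G \<subseteq> Pow {1..d}"
    and "u \<rightarrow>\<^bsub>G\<^esub> v \<longleftrightarrow> u \<in> verts G \<and> v \<in> verts G \<and> adj u v"
proof -
  interpret H: graph "hypercube d" by (rule graph_hypercube)
  interpret digraph G by (rule H.digraphI_induced[OF assms])
  interpret sym_digraph G by (rule H.induced_graph_imp_graph[OF assms])
  show "graph G" by unfold_locales
  show V: "verts G \<subseteq> Pow {1..d}"
    using assms by (auto simp: induced_subgraph_def subgraph_def hypercube_def)
  have th: "tail G = fst" "head G = snd"
    using assms by (auto simp: induced_subgraph_def subgraph_def compatible_def hypercube_def)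
  have "arcs G = {e \<in> arcs (hypercube d). fst e \<in> verts G \<and> snd e \<in> verts G}"
    using assms by (auto simp: induced_subgraph_def hypercube_def)
  moreover have "arcs_ends G = arcs G"
    by (auto simp: arcs_ends_def arc_to_ends_def th)
  ultimately show "u \<rightarrow>\<^bsub>G\<^esub> v \<longleftrightarrow> u \<in> verts G \<and> v \<in> verts G \<and> adj u v"
    using V by (auto simp: hypercube_arcs_iff)
qed

theorem theorem1p1:
  fixes d n :: nat and G :: "(nat set, nat set \<times> nat set) pre_digraph"
  assumes "d \<ge> 1"
    and "induced_subgraph G (hypercube d)"
    and "card (verts G) = n"
    and "n \<le> d"
    and "n \<ge> 103"
  shows "lambda1 G \<le> sqrt (real n - 1) \<and>
    (lambda1 G = sqrt (real n - 1) \<longleftrightarrow> complete_bipartite_digraph 1 (n - 1) G)"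
proof -
  let ?V = "verts G" and ?l = "lambda1 G"
  note G = induced_subgraph_hypercube[OF assms(2)]
  have finV: "finite ?V" using G(2) by (rule finite_subset) simp
  then obtain vs where vs: "set vs = ?V" "distinct vs" using finite_distinct_list by blast
  have ne: "?V \<noteq> {}" using assms(3,5) by auto
  have "eigenvalue (adjacency_mat vs G) ?l"
    by (rule lambda1_eigenvalue[OF G(1) ne vs(2,1)])
  then obtain f where f0: "\<exists>v\<in>?V. f v \<noteq> 0"
    and f: "\<And>v. v \<in> ?V \<Longrightarrow> (\<Sum>u | u \<in> ?V \<and> v \<rightarrow>\<^bsub>G\<^esub> u. f u) = ?l * f v"
    unfolding eigenvalue_adjacency_mat[OF vs(2,1)] by blast
  have row: "(\<Sum>u\<in>?V. of_bool (adj v u) * f u) = ?l * f v" if v: "v \<in> ?V" for v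
  proof -
    have "(\<Sum>u\<in>?V. of_bool (adj v u) * f u) = (\<Sum>u\<in>{u \<in> ?V. v \<rightarrow>\<^bsub>G\<^esub> u}. f u)"
      unfolding sum.inter_filter[OF finV] by (rule sum.cong) (use v in \<open>auto simp: G(3)\<close>)
    then show ?thesis using f[OF v] by simp
  qed
  \<comment> \<open>Absolute values give the nonnegative vector that compression requires; the norm
    is kept and the form can only grow.\<close>
  define h where "h v = \<bar>f v\<bar>" for v
  define N where "N = (\<Sum>v\<in>?V. h v ^ 2)"
  define q where "q = (\<Sum>v\<in>?V. \<Sum>u\<in>?V. of_bool (adj v u) * (h v * h u))"
  have "N > 0"
  proof -
    obtain v where "v \<in> ?V" "f v \<noteq> 0" using f0 by blast
    then show ?thesis unfolding N_def h_def by (intro sum_pos2[OF finV, of v]) auto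
  qed
  have "?l * N = (\<Sum>v\<in>?V. f v * (?l * f v))"
    by (simp add: N_def h_def sum_distrib_left power2_eq_square mult_ac)
  also have "\<dots> = (\<Sum>v\<in>?V. f v * (\<Sum>u\<in>?V. of_bool (adj v u) * f u))"
    by (rule sum.cong) (simp_all only: row)
  also have "\<dots> = (\<Sum>v\<in>?V. \<Sum>u\<in>?V. of_bool (adj v u) * (f v * f u))"
    by (simp add: sum_distrib_left mult_ac)
  also have "\<dots> \<le> q"
    unfolding q_def h_def abs_mult[symmetric] by (intro sum_mono mult_left_mono) auto
  finally have lq: "?l * N \<le> q" .
  note form = adj_form_le_sqrt[OF finite_atLeastAtMost G(2), of h, folded N_def q_def, unfolded assms(3)]
  have q_le: "q \<le> sqrt (real n - 1) * N" using form(1) assms(5) by (simp add: h_def)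
  have le: "?l \<le> sqrt (real n - 1)" using lq q_le \<open>N > 0\<close> by (meson mult_right_le_imp_le order_trans)
  have "complete_bipartite_digraph 1 (n - 1) G" if eq: "?l = sqrt (real n - 1)"
  proof -
    have "q = sqrt (real n - 1) * N" using lq q_le eq by simp
    then obtain P R where "?V = P \<union> R" "P \<inter> R = {}" "card P = 1" "card R = n - 1"
      and adj: "\<forall>S\<in>?V. \<forall>T\<in>?V. adj S T \<longleftrightarrow> (S, T) \<in> P \<times> R \<union> R \<times> P"
      using form(2) assms(5) \<open>N > 0\<close> unfolding h_def by auto
    moreover have "arcs_ends G = P \<times> R \<union> R \<times> P"
    proof -
      have "p \<in> arcs_ends G \<longleftrightarrow> p \<in> P \<times> R \<union> R \<times> P" for p
        using adj G(3)[of "fst p" "snd p"] \<open>?V = P \<union> R\<close> by (cases p) auto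
      then show ?thesis by blast
    qed
    ultimately show ?thesis using G(1) unfolding complete_bipartite_digraph_def by blast
  qed
  moreover have "?l = sqrt (real n - 1)" if K: "complete_bipartite_digraph 1 (n - 1) G"
  proof -
    obtain P R where V: "?V = P \<union> R" "P \<inter> R = {}" "card P = 1" "card R = n - 1"
      and ends: "arcs_ends G = P \<times> R \<union> R \<times> P"
      using K unfolding complete_bipartite_digraph_def by blast
    obtain c where P: "P = {c}" using V(3) by (rule card_1_singletonE)
    \<comment> \<open>The top eigenvector of a star, with value 1 on the \<open>n - 1\<close>
      leaves.\<close>
    define k where "k v = (if v = c then sqrt (real n - 1) else 1)" for v
    have n1: "real (n - 1) = real n - 1" "real n - 1 > 0" using assms(5) by auto
    have "(\<Sum>u | u \<in> ?V \<and> v \<rightarrow>\<^bsub>G\<^esub> u. k u) = sqrt (real n - 1) * k v" if v: "v \<in> ?V" for v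
    proof (cases "v = c")
      case True
      then have "{u. u \<in> ?V \<and> v \<rightarrow>\<^bsub>G\<^esub> u} = R" using V(1,2) P by (auto simp: ends)
      moreover have "sum k R = sum (\<lambda>_. 1) R"
        by (rule sum.cong) (use V(2) P in \<open>auto simp: k_def\<close>)
      ultimately show ?thesis using True n1 V(4) by (simp add: k_def)
    next
      case False
      then have "{u. u \<in> ?V \<and> v \<rightarrow>\<^bsub>G\<^esub> u} = {c}" using V(1,2) P v by (auto simp: ends)
      then show ?thesis using False by (simp add: k_def)
    qed
    moreover have "c \<in> ?V" "k c \<noteq> 0" using V(1) P n1 by (auto simp: k_def)
    ultimately have "eigenvalue (adjacency_mat vs G) (sqrt (real n - 1))"
      unfolding eigenvalue_adjacency_mat[OF vs(2,1)] by blast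
    then have "sqrt (real n - 1) \<le> ?l" by (rule lambda1_ge[OF G(1) ne vs(2,1)])
    then show ?thesis using le by simp
  qed
  ultimately show ?thesis using le by blast
qed

end
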